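(* Let $p\in(0,1)$. The family $\gamma'_p=(\gamma'_{p,\Lambda})_{\Lambda\Subset\mathbb{Z}}$ of kernels defined, for every finite $\Lambda\subset\mathbb{Z}$ and every $\omega'\in\Omega'$, by $$\gamma'_{p,\Lambda}(\omega'_\Lambda\mid\omega'_{\Lambda^c})=\frac{1}{Z_\Lambda(\omega'_{\Lambda^c})}\,p^{|\Theta\cap\bar\Lambda|}(1-p)^{|\partial_+\Theta\cap\bar\Lambda|}\prod_{U\in\mathscr U_\Lambda(\omega')}Z(U),$$ where $\Theta=\Theta(\omega')$, and $Z_\Lambda(\omega'_{\Lambda^c})$ is the normalizing constant making $\gamma'_{p,\Lambda}(\cdot\mid\omega'_{\Lambda^c})$ a probability distribution on $\{\xi_\Lambda\in\{0,1\}^\Lambda:\ \xi_\Lambda\omega'_{\Lambda^c}\in\Omega'\}$, is a specification on $(\Omega',\mathscr F')$, and the TBF $\mu'_p$ is a Gibbs measure for it, i.e. $\mu'_p\in\mathscr G(\gamma'_p)$.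
   Context: Fix $p\in(0,1)$. Let $\Omega=\{0,1\}^{\mathbb{Z}}$ with product $\sigma$-algebra $\mathscr F$, and $\mu_p=\mathrm{Ber}(p)^{\otimes\mathbb{Z}}$ (each site is occupied, i.e. has value $1$, independently with probability $p$). Define $T:\Omega\to\Omega$ by $(T\omega)_i=\omega_i\big(1-(1-\omega_{i-1})(1-\omega_{i+1})\big)$ (removal of isolated occupied sites). Let $\Omega'=T(\Omega)$ (the configurations in which every occupied site has an occupied neighbour), $\mathscr F'=\mathscr F\cap\Omega'$ the trace $\sigma$-algebra, $\mathscr F'_\Delta$ the trace of the $\sigma$-algebra generated by the spins in $\Delta$, and the thinned Bernoulli field (TBF) $\mu'_p=\mu_p\circ T^{-1}$ on $(\Omega',\mathscr F')$. For $\omega\in\Omega$ and $\Delta\subset\mathbb{Z}$, $\omega_\Delta$ is the restriction to $\Delta$ and $\xi_\Lambda\eta_{\Lambda^c}$ denotes concatenation. Transfer matrix: $Q$ is the $2\times2$ matrix indexed by $\{0,1\}$ with $Q(0,0)=1-p$, $Q(0,1)=Q(1,0)=\sqrt{p(1-p)}$, $Q(1,1)=0$; its eigenvalues are $\lambda_{PF}=\tfrac12\big(1-p+\sqrt{(1-p)(3p+1)}\big)\in(0,1)$ and $\lambda_r=\tfrac12\big(1-p-\sqrt{(1-p)(3p+1)}\big)\in(-\tfrac13,0)$; $Q^m(x,y)$ denotes entries of the $m$-th matrix power. Geometry: for $A\subset\mathbb{Z}$, $\partial_+A=\{j\notin A: |j-i|=1\text{ for some }i\in A\}$ and $\bar A=A\cup\partial_+A$.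 For $\omega'\in\Omega'$ let $\Theta(\omega')=\{x:\omega'_x=1\}$, the fixed area $\bar\Theta=\Theta\cup\partial_+\Theta$, and $\mathscr U(\omega')$ the set of connected components (maximal integer intervals, possibly infinite) of $\mathbb{Z}\setminus\bar\Theta$. For finite $\Lambda$, $\mathscr U_\Lambda(\omega')=\{U\in\mathscr U(\omega'):\mathrm{dist}(\bar\Lambda,U)\le1\}$, $V_-=[\min\bar\Lambda,+\infty)$, $V_+=(-\infty,\max\bar\Lambda]$. For $U\in\mathscr U_\Lambda(\omega')$ set $Z(U)=(1-p)^{-1}Q^{|U|+1}(0,0)$ if $U$ is finite; $Z(U)=(1-p)^{-1}\lambda_{PF}^{|U\cap V_-|}$ if $U$ is infinite with $\sup U<\infty$; $Z(U)=(1-p)^{-1}\lambda_{PF}^{|U\cap V_+|}$ if $U$ is infinite with $\inf U>-\infty$; and $Z(U)=(1-p)^{-1}D\,\lambda_{PF}^{|V_-\cap V_+|}$ if $U=\mathbb{Z}$, where $D=(1-p)(\lambda_{PF}+2p)/\lambda_{PF}^3$. A specification on $(\Omega',\mathscr F')$ is a family of probability kernels $\gamma_\Lambda$, $\Lambda\Subset\mathbb{Z}$, from $(\Omega',\mathscr F'_{\Lambda^c})$ to $(\Omega',\mathscr F')$, which are proper ($\gamma_\Lambda(B\mid\omega)=\mathbb 1_B(\omega)$ for $B\in\mathscr F'_{\Lambda^c}$) and consistent ($\gamma_\Delta\gamma_\Lambda=\gamma_\Delta$ for $\Lambda\subset\Delta\Subset\mathbb{Z}$). A probability measure $\mu$ is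 a Gibbs measure for $\gamma$ ($\mu\in\mathscr G(\gamma)$) if $\mu(B\mid\mathscr F'_{\Lambda^c})=\gamma_\Lambda(B\mid\cdot)$ $\mu$-a.s. for all $\Lambda\Subset\mathbb{Z}$ and $B\in\mathscr F'$. *)

theory Defs
  imports "HOL-Probability.Probability"
begin

type_synonym cfg = "int \<Rightarrow> bool"  \<comment> \<open>True = occupied (spin 1)\<close>

definition thin :: "cfg \<Rightarrow> cfg" where
  "thin \<omega> = (\<lambda>i. \<omega> i \<and> (\<omega> (i - 1) \<or> \<omega> (i + 1)))"

definition Omega' :: "cfg set" where
  "Omega' = range thin"

definition OmegaM :: "cfg measure" where
  "OmegaM = PiM UNIV (\<lambda>_. count_space UNIV)"

definition F_spins :: "int set \<Rightarrow> cfg measure" where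
  "F_spins \<Delta> = vimage_algebra (space OmegaM) (\<lambda>\<omega>. restrict \<omega> \<Delta>) (PiM \<Delta> (\<lambda>_. count_space UNIV))"

definition F' :: "cfg measure" where
  "F' = restrict_space OmegaM Omega'"

definition F'_spins :: "int set \<Rightarrow> cfg measure" where
  "F'_spins \<Delta> = restrict_space (F_spins \<Delta>) Omega'"

definition mu :: "real \<Rightarrow> cfg measure" where
  "mu p = PiM UNIV (\<lambda>_. measure_pmf (bernoulli_pmf p))"

definition mu' :: "real \<Rightarrow> cfg measure" where
  "mu' p = distr (mu p) F' thin"

definition Qm :: "real \<Rightarrow> bool \<Rightarrow> bool \<Rightarrow> real" where
  "Qm p x y = (if \<not> x \<and> \<not> y then 1 - p else if x \<and> y then 0 else sqrt (p * (1 - p)))"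

fun Qpow :: "real \<Rightarrow> nat \<Rightarrow> bool \<Rightarrow> bool \<Rightarrow> real" where
  "Qpow p 0 x y = (if x = y then 1 else 0)"
| "Qpow p (Suc m) x y = (\<Sum>z\<in>UNIV. Qpow p m x z * Qm p z y)"

definition lamPF :: "real \<Rightarrow> real" where
  "lamPF p = (1 - p + sqrt ((1 - p) * (3 * p + 1))) / 2"

definition Dconst :: "real \<Rightarrow> real" where
  "Dconst p = (1 - p) * (lamPF p + 2 * p) / lamPF p ^ 3"

definition bdry :: "int set \<Rightarrow> int set" where
  "bdry A = {j. j \<notin> A \<and> (\<exists>i\<in>A. \<bar>j - i\<bar> = 1)}"

definition clos :: "int set \<Rightarrow> int set" where
  "clos A = A \<union> bdry A"

definition Theta :: "cfg \<Rightarrow> int set" where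
  "Theta \<omega> = {x. \<omega> x}"

definition comps :: "int set \<Rightarrow> int set set" where
  "comps S = {{y. {min x y..max x y} \<subseteq> S} | x. x \<in> S}"

definition Ucomps :: "cfg \<Rightarrow> int set set" where
  "Ucomps \<omega> = comps (- clos (Theta \<omega>))"

definition UL :: "int set \<Rightarrow> cfg \<Rightarrow> int set set" where
  "UL \<Lambda> \<omega> = {U \<in> Ucomps \<omega>. \<exists>a\<in>clos \<Lambda>. \<exists>u\<in>U. \<bar>a - u\<bar> \<le> 1}"

definition Vminus :: "int set \<Rightarrow> int set" where
  "Vminus \<Lambda> = {Min (clos \<Lambda>)..}"

definition Vplus :: "int set \<Rightarrow> int set" where
  "Vplus \<Lambda> = {..Max (clos \<Lambda>)}"

definition Zc :: "real \<Rightarrow> int set \<Rightarrow> int set \<Rightarrow> real" where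
  "Zc p \<Lambda> U =
     (if finite U then Qpow p (card U + 1) False False / (1 - p)
      else if U = UNIV then Dconst p * lamPF p ^ card (Vminus \<Lambda> \<inter> Vplus \<Lambda>) / (1 - p)
      else if bdd_above U then lamPF p ^ card (U \<inter> Vminus \<Lambda>) / (1 - p)
      else if bdd_below U then lamPF p ^ card (U \<inter> Vplus \<Lambda>) / (1 - p)
      else 0)"

text \<open>Unnormalised weight of the full configuration eta (= xi_Lambda omega_Lambda^c).\<close>
definition Wt :: "real \<Rightarrow> int set \<Rightarrow> cfg \<Rightarrow> real" where
  "Wt p \<Lambda> \<eta> = p ^ card (Theta \<eta> \<inter> clos \<Lambda>) * (1 - p) ^ card (bdry (Theta \<eta>) \<inter> clos \<Lambda>)
                 * (\<Prod>U\<in>UL \<Lambda> \<eta>. Zc p \<Lambda> U)"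

definition Conf :: "int set \<Rightarrow> cfg \<Rightarrow> cfg set" where
  "Conf \<Lambda> \<omega> = {\<eta> \<in> Omega'. \<forall>i. i \<notin> \<Lambda> \<longrightarrow> \<eta> i = \<omega> i}"

definition Zpart :: "real \<Rightarrow> int set \<Rightarrow> cfg \<Rightarrow> real" where
  "Zpart p \<Lambda> \<omega> = (\<Sum>\<eta>\<in>Conf \<Lambda> \<omega>. Wt p \<Lambda> \<eta>)"

definition gamma' :: "real \<Rightarrow> int set \<Rightarrow> cfg \<Rightarrow> cfg measure" where
  "gamma' p \<Lambda> \<omega> = measure_of Omega' (sets F')
     (\<lambda>B. ennreal ((\<Sum>\<eta>\<in>Conf \<Lambda> \<omega> \<inter> B. Wt p \<Lambda> \<eta>) / Zpart p \<Lambda> \<omega>))"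

definition is_specification :: "(int set \<Rightarrow> cfg \<Rightarrow> cfg measure) \<Rightarrow> bool" where
  "is_specification \<gamma> \<longleftrightarrow>
     (\<forall>\<Lambda>. finite \<Lambda> \<longrightarrow>
        (\<forall>\<omega>\<in>Omega'. prob_space (\<gamma> \<Lambda> \<omega>) \<and> sets (\<gamma> \<Lambda> \<omega>) = sets F') \<and>
        (\<forall>B\<in>sets F'. (\<lambda>\<omega>. emeasure (\<gamma> \<Lambda> \<omega>) B) \<in> borel_measurable (F'_spins (- \<Lambda>))) \<and>
        (\<forall>B\<in>sets (F'_spins (- \<Lambda>)). \<forall>\<omega>\<in>Omega'. emeasure (\<gamma> \<Lambda> \<omega>) B = indicator B \<omega>)) \<and>
     (\<forall>\<Lambda> \<Delta>. finite \<Delta> \<and> \<Lambda> \<subseteq> \<Delta> \<longrightarrow>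
        (\<forall>B\<in>sets F'. \<forall>\<omega>\<in>Omega'.
           (\<integral>\<^sup>+\<eta>. emeasure (\<gamma> \<Lambda> \<eta>) B \<partial>(\<gamma> \<Delta> \<omega>)) = emeasure (\<gamma> \<Delta> \<omega>) B))"

text \<open>Gibbs measure: gamma_Lambda(B|.) is a version of mu(B | F'_Lambda^c), expressed
  through the defining property of conditional probability (DLR equations).\<close>
definition is_gibbs :: "(int set \<Rightarrow> cfg \<Rightarrow> cfg measure) \<Rightarrow> cfg measure \<Rightarrow> bool" where
  "is_gibbs \<gamma> \<mu> \<longleftrightarrow> prob_space \<mu> \<and> sets \<mu> = sets F' \<and>
     (\<forall>\<Lambda>. finite \<Lambda> \<longrightarrow> (\<forall>B\<in>sets F'. \<forall>A\<in>sets (F'_spins (- \<Lambda>)).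
        emeasure \<mu> (A \<inter> B) = (\<integral>\<^sup>+\<omega>\<in>A. emeasure (\<gamma> \<Lambda> \<omega>) B \<partial>\<mu>)))"

end

theory Submission
  imports Defs
begin

text \<open>
  Consistency. If \<open>\<Lambda> \<subseteq> \<Delta>\<close> and two configurations agree off \<open>\<Lambda>\<close>, then the unnormalised weights for
  \<open>\<Lambda>\<close> and \<open>\<Delta>\<close> have the same ratio on both: components far from \<open>\<Lambda>\<close> are common to the two
  configurations, and an infinite component contributes a power of \<open>\<lambda>\<close> (the largest eigenvalue) that
  only depends on the distance between the ends of \<open>\<Lambda>\<close> and of \<open>\<Delta>\<close>.

  Gibbs property. If the original field is occupied at \<open>- n - 1, - n, n, n + 1\<close>, then these sites survive
  the thinning and decouple the inside of \<open>(- n, n)\<close> from the outside. Given this, the original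
  configurations inside that thin to a prescribed \<open>\<eta>\<close> are exactly the occupied set of \<open>\<eta>\<close> together with
  a hard-core configuration on each component of the free area, and the transfer matrix sums these to
  \<open>p\<^sup>-\<^sup>2\<close> times the weight of \<open>\<eta>\<close>. So the DLR equation holds for \<open>(- n, n)\<close> on this event;
  consistency and properness carry it to every \<open>\<Lambda> \<subseteq> (- n, n)\<close>, and almost surely some such event
  occurs.
\<close>

section \<open>Components of integer sets\<close>

lemma mem_clos_iff: "j \<in> clos A \<longleftrightarrow> j \<in> A \<or> j - 1 \<in> A \<or> j + 1 \<in> A"
proof -
  have "\<bar>j - i\<bar> = 1 \<longleftrightarrow> i = j - 1 \<or> i = j + 1" for i by linarith
  then show ?thesis unfolding clos_def bdry_def by auto
qed

lemma mem_bdry_iff: "j \<in> bdry A \<longleftrightarrow> j \<notin> A \<and> (j - 1 \<in> A \<or> j + 1 \<in> A)"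
proof -
  have "\<bar>j - i\<bar> = 1 \<longleftrightarrow> i = j - 1 \<or> i = j + 1" for i by linarith
  then show ?thesis unfolding bdry_def by auto
qed

lemma finite_clos: assumes "finite A" shows "finite (clos A)"
proof -
  have "clos A \<subseteq> A \<union> (\<lambda>i. i + 1) ` A \<union> (\<lambda>i. i - 1) ` A"
    by (auto simp: mem_clos_iff image_iff) (metis add_diff_cancel diff_add_cancel)+
  then show ?thesis using assms finite_subset by blast
qed

lemma clos_mono: "A \<subseteq> B \<Longrightarrow> clos A \<subseteq> clos B"
  by (auto simp: mem_clos_iff)

definition free :: "cfg \<Rightarrow> int set" where
  "free \<omega> = {j. \<not> \<omega> (j - 1) \<and> \<not> \<omega> j \<and> \<not> \<omega> (j + 1)}"

lemma free_eq: "- clos (Theta \<omega>) = free \<omega>"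
  by (auto simp: free_def mem_clos_iff Theta_def)

definition iconvex :: "int set \<Rightarrow> bool" where
  "iconvex U \<longleftrightarrow> (\<forall>x\<in>U. \<forall>y\<in>U. {x..y} \<subseteq> U)"

lemma iconvexD: "iconvex U \<Longrightarrow> x \<in> U \<Longrightarrow> y \<in> U \<Longrightarrow> x \<le> z \<Longrightarrow> z \<le> y \<Longrightarrow> z \<in> U"
  unfolding iconvex_def by (meson atLeastAtMost_iff subsetD)

text \<open>The segment between two points is covered by the segments joining each of them to a
  third point, so every point of a component can serve as its base point.\<close>

lemma comps_eq:
  assumes "U \<in> comps S" "x \<in> U"
  shows "U = {y. {min x y..max x y} \<subseteq> S}"
proof -
  obtain z where z: "U = {y. {min z y..max z y} \<subseteq> S}"
    using assms(1) unfolding comps_def by blast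
  have 1: "{min z x..max z x} \<subseteq> S" using assms(2) z by blast
  have "{min z y..max z y} \<subseteq> S \<longleftrightarrow> {min x y..max x y} \<subseteq> S" for y
  proof
    assume a: "{min z y..max z y} \<subseteq> S"
    have "{min x y..max x y} \<subseteq> {min z x..max z x} \<union> {min z y..max z y}" by auto
    then show "{min x y..max x y} \<subseteq> S" using 1 a by blast
  next
    assume a: "{min x y..max x y} \<subseteq> S"
    have "{min z y..max z y} \<subseteq> {min z x..max z x} \<union> {min x y..max x y}" by auto
    then show "{min z y..max z y} \<subseteq> S" using 1 a by blast
  qed
  then show ?thesis using z by blast
qed

text \<open>Replaces path-connectedness by conditions on single sites: an interval in
  \<open>S\<close> is maximal exactly when no site next to it lies in \<open>S\<close>. In this form
  components can be compared between configurations, and being a component becomes a countable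
  conjunction of conditions on spins.\<close>

lemma comps_iff:
  "U \<in> comps S \<longleftrightarrow> U \<noteq> {} \<and> iconvex U \<and> U \<subseteq> S \<and> bdry U \<inter> S = {}"
proof
  assume U: "U \<in> comps S"
  then obtain x where x: "x \<in> S" "U = {y. {min x y..max x y} \<subseteq> S}"
    unfolding comps_def by blast
  have sub: "U \<subseteq> S"
  proof
    fix y assume "y \<in> U"
    moreover have "y \<in> {min x y..max x y}" by simp
    ultimately show "y \<in> S" using x(2) by blast
  qed
  have xU: "x \<in> U" using x by simp
  have conv: "iconvex U" unfolding iconvex_def
  proof (intro ballI subsetI)
    fix a b z assume ab: "a \<in> U" "b \<in> U" "z \<in> {a..b}"
    have "{min x z..max x z} \<subseteq> {min x a..max x a} \<union> {min x b..max x b}"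
      using ab(3) by auto
    moreover have "{min x a..max x a} \<subseteq> S" "{min x b..max x b} \<subseteq> S" using ab x(2) by blast+
    ultimately show "z \<in> U" using x(2) by blast
  qed
  have "bdry U \<inter> S = {}"
  proof (rule ccontr)
    assume "bdry U \<inter> S \<noteq> {}"
    then obtain j where j': "j \<in> S" "j \<in> bdry U" by blast
    then obtain i where j: "j \<in> S" "j \<notin> U" "i \<in> U" "i = j - 1 \<or> i = j + 1"
      unfolding mem_bdry_iff by blast
    have "{min x j..max x j} \<subseteq> {min x i..max x i} \<union> {j}" using j(4) by auto
    moreover have "{min x i..max x i} \<subseteq> S" using j x(2) by blast
    ultimately have "j \<in> U" using x(2) j(1) by blast
    then show False using j(2) by simp
  qed
  then show "U \<noteq> {} \<and> iconvex U \<and> U \<subseteq> S \<and> bdry U \<inter> S = {}"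
    using sub xU conv by blast
next
  assume U: "U \<noteq> {} \<and> iconvex U \<and> U \<subseteq> S \<and> bdry U \<inter> S = {}"
  then obtain x where x: "x \<in> U" by blast
  have nbr: "k \<in> U \<Longrightarrow> j = k - 1 \<or> j = k + 1 \<Longrightarrow> j \<in> S \<Longrightarrow> j \<in> U" for k j
    using U mem_bdry_iff[of j U] by auto
  have "U = {y. {min x y..max x y} \<subseteq> S}"
  proof (intro set_eqI iffI)
    fix y assume y: "y \<in> U"
    have "{min x y..max x y} \<subseteq> U"
      using U x y by (cases "x \<le> y") (auto simp: iconvex_def)
    then show "y \<in> {y. {min x y..max x y} \<subseteq> S}" using U by blast
  next
    fix y assume "y \<in> {y. {min x y..max x y} \<subseteq> S}"
    then have y: "{min x y..max x y} \<subseteq> S" by simp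
    show "y \<in> U"
    proof (cases "x \<le> y")
      case True
      \<comment> \<open>Walk from \<open>x\<close> towards \<open>y\<close> one site at a time: each
        new site is in \<open>S\<close> and next to \<open>U\<close>, so by \<open>nbr\<close> the
        walk never leaves \<open>U\<close>.\<close>
      have "k \<le> y \<longrightarrow> k \<in> U" if "x \<le> k" for k using that
      proof (induction k rule: int_ge_induct)
        case base then show ?case using x by simp
      next
        case (step i)
        show ?case
        proof
          assume le: "i + 1 \<le> y"
          then have "i + 1 \<in> S" using y step(1) by auto
          then show "i + 1 \<in> U" using step le nbr by auto
        qed
      qed
      then show ?thesis using True by blast
    next
      case False
      have "y \<le> k \<longrightarrow> k \<in> U" if "k \<le> x" for k using that
      proof (induction k rule: int_le_induct)
        case base then show ?case using x by simp
      next
        case (step i)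
        show ?case
        proof
          assume le: "y \<le> i - 1"
          then have "i - 1 \<in> S" using y step(1) by auto
          then show "i - 1 \<in> U" using step le nbr by auto
        qed
      qed
      then show ?thesis using False by auto
    qed
  qed
  then show "U \<in> comps S" using x U unfolding comps_def by blast
qed

lemma comps_cover: "x \<in> S \<Longrightarrow> \<exists>U\<in>comps S. x \<in> U"
  unfolding comps_def by (rule bexI[of _ "{y. {min x y..max x y} \<subseteq> S}"]) auto

lemma comps_disjoint: "U \<in> comps S \<Longrightarrow> V \<in> comps S \<Longrightarrow> U \<noteq> V \<Longrightarrow> U \<inter> V = {}"
  using comps_eq by blast

lemma Ucomps_eq: "Ucomps \<omega> = comps (free \<omega>)"
  by (simp add: Ucomps_def free_eq)

text \<open>Being within distance one of \<open>clos \<Lambda>\<close> means meeting its closure;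
  taking closures twice keeps all distances out of the later arguments.\<close>

lemma UL_eq: "UL \<Lambda> \<omega> = {U \<in> comps (free \<omega>). U \<inter> clos (clos \<Lambda>) \<noteq> {}}"
proof -
  have "(\<exists>a\<in>A. \<bar>a - u\<bar> \<le> 1) \<longleftrightarrow> u \<in> A \<or> u - 1 \<in> A \<or> u + 1 \<in> A" for A and u :: int
  proof -
    have "\<bar>a - u\<bar> \<le> 1 \<longleftrightarrow> a = u \<or> a = u - 1 \<or> a = u + 1" for a by linarith
    then show ?thesis by metis
  qed
  then have "(\<exists>a\<in>clos \<Lambda>. \<bar>a - u\<bar> \<le> 1) \<longleftrightarrow> u \<in> clos (clos \<Lambda>)" for u
    by (simp add: mem_clos_iff[of _ "clos \<Lambda>"])
  then show ?thesis unfolding UL_def Ucomps_eq by blast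
qed

lemma finite_UL: assumes "finite \<Lambda>" shows "finite (UL \<Lambda> \<omega>)"
proof (rule finite_subset)
  \<comment> \<open>A component is determined by any of its points, and each of these has a point in
    the finite set \<open>clos (clos \<Lambda>)\<close>.\<close>
  show "UL \<Lambda> \<omega> \<subseteq> (\<lambda>x. {y. {min x y..max x y} \<subseteq> free \<omega>}) ` clos (clos \<Lambda>)"
    using comps_eq by (fastforce simp: UL_eq)
  show "finite \<dots>" using assms by (simp add: finite_clos)
qed

lemma UL_mono: "\<Lambda> \<subseteq> \<Delta> \<Longrightarrow> UL \<Lambda> \<omega> \<subseteq> UL \<Delta> \<omega>"
  unfolding UL_eq using clos_mono[OF clos_mono[of \<Lambda> \<Delta>]] by blast

lemma free_agree:
  assumes "\<And>i. i \<notin> \<Lambda> \<Longrightarrow> \<eta> i = \<eta>' i" "j \<notin> clos \<Lambda>"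
  shows "j \<in> free \<eta> \<longleftrightarrow> j \<in> free \<eta>'"
  using assms by (auto simp: free_def mem_clos_iff)

text \<open>If \<open>U\<close> misses \<open>clos (clos \<Lambda>)\<close>, then \<open>U\<close>
  and its boundary both miss \<open>clos \<Lambda>\<close>. There, freeness depends only on spins
  outside \<Lambda>, so both the inclusion and the maximality of \<open>U\<close> carry
  over.\<close>

lemma comps_off_agree:
  assumes ag: "\<And>i. i \<notin> \<Lambda> \<Longrightarrow> \<eta> i = \<eta>' i"
    and U: "U \<in> comps (free \<eta>)" "U \<inter> clos (clos \<Lambda>) = {}"
  shows "U \<in> comps (free \<eta>')"
proof -
  have 1: "j \<notin> clos \<Lambda>" if "j \<in> U" for j using U(2) that by (auto simp: mem_clos_iff[of _ "clos \<Lambda>"])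
  have 2: "j \<notin> clos \<Lambda>" if "j \<in> bdry U" for j
    using U(2) that by (auto simp: mem_clos_iff[of _ "clos \<Lambda>"] mem_bdry_iff)
  show ?thesis using U(1) free_agree[of \<Lambda> \<eta> \<eta>', OF ag] 1 2 unfolding comps_iff by blast
qed

text \<open>The components counted for \<Delta> but not for \<Lambda> are far from \<Lambda>, hence
  shared; their factors will cancel in ratios of weights.\<close>

lemma UL_diff_agree:
  assumes ag: "\<And>i. i \<notin> \<Lambda> \<Longrightarrow> \<eta> i = \<eta>' i"
  shows "UL \<Delta> \<eta> - UL \<Lambda> \<eta> = UL \<Delta> \<eta>' - UL \<Lambda> \<eta>'"
proof -
  have ag': "\<And>i. i \<notin> \<Lambda> \<Longrightarrow> \<eta>' i = \<eta> i" using ag by simp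
  show ?thesis
    using comps_off_agree[of \<Lambda> \<eta> \<eta>', OF ag] comps_off_agree[of \<Lambda> \<eta>' \<eta>, OF ag']
    unfolding UL_eq by blast
qed

section \<open>Weights in different volumes\<close>

lemma int_bdd_above_max:
  fixes U :: "int set"
  assumes "bdd_above U" "U \<noteq> {}"
  shows "\<exists>b\<in>U. \<forall>x\<in>U. x \<le> b"
proof -
  obtain B x0 where B: "\<And>x. x \<in> U \<Longrightarrow> x \<le> B" "x0 \<in> U"
    using assms unfolding bdd_above_def by blast
  \<comment> \<open>Cutting \<open>U\<close> at one of its own points leaves a finite nonempty set
    with the same upper end.\<close>
  have "finite (U \<inter> {x0..})" by (rule finite_subset[of _ "{x0..B}"]) (auto dest: B(1))
  moreover have "x0 \<in> U \<inter> {x0..}" using B by simp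
  ultimately show ?thesis
    by (intro bexI[of _ "Max (U \<inter> {x0..})"])
      (metis Int_iff Max_ge atLeast_iff linorder_le_cases order_trans, metis Int_iff Max_in empty_iff)
qed

lemma int_bdd_below_min:
  fixes U :: "int set"
  assumes "bdd_below U" "U \<noteq> {}"
  shows "\<exists>b\<in>U. \<forall>x\<in>U. b \<le> x"
proof -
  have "bdd_above (uminus ` U)" using assms by simp
  from int_bdd_above_max[OF this] assms(2) show ?thesis by auto
qed

text \<open>The four shapes match the branches of \<open>Zc\<close>; boundedness is recorded with
  each shape because the definition branches on it.\<close>

lemma iconvex_cases:
  assumes "iconvex U" "U \<noteq> {}"
  obtains (fin) a b where "U = {a..b}" "bdd_below U" "bdd_above U" "a \<le> b"
  | (univ) "U = UNIV" "\<not> bdd_below U" "\<not> bdd_above U"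
  | (left) b where "U = {..b}" "\<not> bdd_below U" "bdd_above U"
  | (right) a where "U = {a..}" "bdd_below U" "\<not> bdd_above U"
proof -
  have up: "\<exists>y\<in>U. x \<le> y" if "\<not> bdd_above U" for x
    using that unfolding bdd_above_def by (meson linear)
  have dn: "\<exists>y\<in>U. y \<le> x" if "\<not> bdd_below U" for x
    using that unfolding bdd_below_def by (meson linear)
  note mx = int_bdd_above_max[OF _ assms(2)] and mn = int_bdd_below_min[OF _ assms(2)]
  note c = iconvexD[OF assms(1)]
  consider "bdd_below U" "bdd_above U" | "\<not> bdd_below U" "\<not> bdd_above U"
    | "\<not> bdd_below U" "bdd_above U" | "bdd_below U" "\<not> bdd_above U" by metis
  then show ?thesis
  proof cases
    case 1
    obtain a where a: "a \<in> U" "\<forall>x\<in>U. a \<le> x" using mn[OF 1(1)] by blast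
    obtain b where b: "b \<in> U" "\<forall>x\<in>U. x \<le> b" using mx[OF 1(2)] by blast
    have "U = {a..b}"
    proof (intro set_eqI iffI)
      fix x assume "x \<in> U" then show "x \<in> {a..b}" using a(2) b(2) by simp
    next
      fix x assume "x \<in> {a..b}" then show "x \<in> U" using c[OF a(1) b(1)] by simp
    qed
    then show ?thesis by (rule fin[OF _ 1]) (use a b in blast)
  next
    case 2
    have "x \<in> U" for x using up[OF 2(2), of x] dn[OF 2(1), of x] c by blast
    then show ?thesis by (intro univ 2) auto
  next
    case 3
    obtain b where b: "b \<in> U" "\<forall>x\<in>U. x \<le> b" using mx[OF 3(2)] by blast
    have "x \<in> U" if "x \<le> b" for x using dn[OF 3(1), of x] c b that by blast
    then have "U = {..b}" using b by auto
    then show ?thesis by (rule left[OF _ 3])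
  next
    case 4
    obtain a where a: "a \<in> U" "\<forall>x\<in>U. a \<le> x" using mn[OF 4(1)] by blast
    have "x \<in> U" if "a \<le> x" for x using up[OF 4(2), of x] c a that by blast
    then have "U = {a..}" using a by auto
    then show ?thesis by (rule right[OF _ 4])
  qed
qed

section \<open>Transfer matrix recursion and positivity of the weights\<close>

lemma lamPF_pos: assumes "0 < p" "p < 1" shows "0 < lamPF p"
proof -
  have "0 \<le> sqrt ((1 - p) * (3 * p + 1))" using assms by simp
  then show ?thesis using assms unfolding lamPF_def by (simp add: add_pos_nonneg)
qed

lemma Dconst_pos: assumes "0 < p" "p < 1" shows "0 < Dconst p"
  using lamPF_pos[OF assms] assms unfolding Dconst_def by simp

text \<open>This is the Cayley-Hamilton relation for a matrix of trace \<open>1 - p\<close> and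
  determinant \<open>- p * (1 - p)\<close>. Since Q(1,1) = 0, unfolding two multiplications already
  gives it.\<close>

lemma Qpow_rec:
  assumes "0 < p" "p < 1"
  shows "Qpow p (Suc (Suc n)) False False
    = (1 - p) * Qpow p (Suc n) False False + p * (1 - p) * Qpow p n False False"
proof -
  have "sqrt (p * (1 - p)) * sqrt (p * (1 - p)) = p * (1 - p)" using assms by simp
  then show ?thesis
    by (simp add: UNIV_bool Qm_def algebra_simps)
qed

lemma Qpow_pos: assumes "0 < p" "p < 1" shows "0 < Qpow p n False False"
proof (induction n rule: induct_nat_012)
  case 0 then show ?case by simp
next
  case 1 then show ?case using assms by (simp add: UNIV_bool Qm_def)
next
  case (ge2 n)
  then show ?case unfolding Qpow_rec[OF assms] using assms
    by (intro add_pos_pos mult_pos_pos) auto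
qed

lemma Zc_pos:
  assumes "0 < p" "p < 1" "iconvex U" "U \<noteq> {}"
  shows "0 < Zc p \<Lambda> U"
  using assms(3,4)
proof (cases rule: iconvex_cases)
  case fin then show ?thesis using Qpow_pos[OF assms(1,2)] assms by (simp add: Zc_def del: Qpow.simps)
next
  case univ then show ?thesis
    using lamPF_pos[OF assms(1,2)] Dconst_pos[OF assms(1,2)] assms by (simp add: Zc_def)
next
  case (left b)
  then have "infinite U" "U \<noteq> UNIV" by (auto simp: infinite_Iic bdd_above_def) 
  then show ?thesis using left lamPF_pos[OF assms(1,2)] assms by (simp add: Zc_def)
next
  case (right b)
  then have "infinite U" "U \<noteq> UNIV" by (auto simp: infinite_Ici)
  then show ?thesis using right lamPF_pos[OF assms(1,2)] assms by (simp add: Zc_def)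
qed

lemma Wt_pos:
  assumes "0 < p" "p < 1" shows "0 < Wt p \<Lambda> \<eta>"
  unfolding Wt_def using assms
  by (auto intro!: mult_pos_pos prod_pos Zc_pos simp: UL_eq comps_iff)

text \<open>A finite component has a factor independent of the volume. Each direction in which
  \<open>U\<close> is unbounded contributes a power of \<open>lamPF p\<close> whose exponent grows
  by the distance between the corresponding ends of the two volumes; for \<open>U = UNIV\<close>
  both directions contribute and the constant \<open>Dconst p\<close> is unchanged.\<close>

lemma Zc_volume:
  assumes fin: "finite \<Delta>" and sub: "\<Lambda> \<subseteq> \<Delta>" and ne: "\<Lambda> \<noteq> {}" and U: "U \<in> UL \<Lambda> \<eta>"
  shows "Zc p \<Delta> U =
      (if bdd_below U then 1 else lamPF p ^ nat (Min (clos \<Lambda>) - Min (clos \<Delta>)))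
    * ((if bdd_above U then 1 else lamPF p ^ nat (Max (clos \<Delta>) - Max (clos \<Lambda>))) * Zc p \<Lambda> U)"
proof -
  define a A b B where d: "a = Min (clos \<Lambda>)" "A = Min (clos \<Delta>)" "b = Max (clos \<Lambda>)" "B = Max (clos \<Delta>)"
  have cl: "finite (clos \<Delta>)" "finite (clos \<Lambda>)" "clos \<Lambda> \<subseteq> clos \<Delta>" "clos \<Lambda> \<noteq> {}"
    using finite_clos[OF fin] finite_clos[OF finite_subset[OF sub fin]] clos_mono[OF sub] ne
    by (simp_all add: clos_def)
  have ab: "A \<le> a" "a \<le> b" "b \<le> B"
    using cl d by (auto intro: Min_antimono Max_mono Min_le_iff[THEN iffD2])
  have conv: "iconvex U" "U \<noteq> {}" using U by (auto simp: UL_eq comps_iff)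
  obtain u v where u: "u \<in> U" "v \<in> clos \<Lambda>" "\<bar>v - u\<bar> \<le> 1" using U unfolding UL_def by blast
  \<comment> \<open>A half-infinite component may stop one site short of
    \<open>clos \<Lambda>\<close>. Its part counted in \<Lambda> is then empty, and this bound is
    just enough for the cardinalities below to add up.\<close>
  then have ua: "a - 1 \<le> u" "u \<le> b + 1"
    using Min_le[OF cl(2) u(2)] Max_ge[OF cl(2) u(2)] unfolding d by linarith+
  note V = Vminus_def Vplus_def d[symmetric]
  show ?thesis using conv
  proof (cases rule: iconvex_cases)
    case fin then show ?thesis by (simp add: Zc_def)
  next
    case univ
    have 1: "{A..} \<inter> {..B} = {A..B}" "{a..} \<inter> {..b} = {a..b}" by auto
    have e: "card {A..B} = nat (a - A) + (nat (B - b) + card {a..b})" using ab by simp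
    show ?thesis using univ unfolding Zc_def V 1 e power_add by (simp del: card_atLeastAtMost_int)
  next
    case (left c)
    have i: "infinite U" "U \<noteq> UNIV" using left by (auto simp: infinite_Iic)
    have 1: "U \<inter> {A..} = {A..c}" "U \<inter> {a..} = {a..c}" using left by auto
    have e: "card {A..c} = nat (a - A) + card {a..c}" using ab ua left u by auto
    show ?thesis using left(2,3) i unfolding Zc_def V 1 e power_add by (simp del: card_atLeastAtMost_int)
  next
    case (right c)
    have i: "infinite U" "U \<noteq> UNIV" using right by (auto simp: infinite_Ici)
    have 1: "U \<inter> {..B} = {c..B}" "U \<inter> {..b} = {c..b}" using right by auto
    have e: "card {c..B} = nat (B - b) + card {c..b}" using ab ua right u by auto
    show ?thesis using right(2,3) i unfolding Zc_def V 1 e power_add by (simp del: card_atLeastAtMost_int)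
  qed
qed

text \<open>At most one component is unbounded below, and one near \<Lambda> exists exactly when the
  whole half-line to the left of \<open>clos \<Lambda>\<close> is free. This criterion only involves
  spins outside \<Lambda>, unlike the component itself, which may reach into \<Lambda>.\<close>

lemma prod_UL_unbdd_below:
  fixes x :: real
  assumes fin: "finite \<Lambda>" and ne: "\<Lambda> \<noteq> {}"
  shows "(\<Prod>U\<in>UL \<Lambda> \<eta>. if bdd_below U then 1 else x)
    = (if {..< Min (clos \<Lambda>)} \<subseteq> free \<eta> then x else 1)"
proof -
  define a where "a = Min (clos \<Lambda>)"
  have cl: "finite (clos \<Lambda>)" "clos \<Lambda> \<noteq> {}" using fin ne finite_clos by (auto simp: clos_def)
  have a: "a \<in> clos \<Lambda>" using cl a_def by simp
  \<comment> \<open>Such a component has a point at or to the right of \<open>a - 1\<close>; being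
    an interval without lower bound, it contains everything to the left of that point.\<close>
  have below: "{..<a} \<subseteq> U" if asm: "U \<in> UL \<Lambda> \<eta>" "\<not> bdd_below U" for U
  proof -
    have conv: "iconvex U" "U \<noteq> {}" using that by (auto simp: UL_eq comps_iff)
    obtain u v where u: "u \<in> U" "v \<in> clos \<Lambda>" "\<bar>v - u\<bar> \<le> 1" using asm(1) unfolding UL_def by blast
    then have le: "a - 1 \<le> u" using Min_le[OF cl(1) u(2)] unfolding a_def by linarith
    show ?thesis using conv
      by (cases rule: iconvex_cases) (use asm u le in auto)
  qed
  show ?thesis unfolding a_def[symmetric]
  proof (cases "{..<a} \<subseteq> free \<eta>")
    case True
    then have "a - 1 \<in> free \<eta>" by auto
    then obtain V where V: "V \<in> comps (free \<eta>)" "a - 1 \<in> V" using comps_cover by blast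
    have sub: "{..<a} \<subseteq> V" using True unfolding comps_eq[OF V] by auto
    have nb: "\<not> bdd_below V"
    proof
      assume "bdd_below V"
      then obtain m where m: "\<forall>v\<in>V. m \<le> v" unfolding bdd_below_def by blast
      have "min m a - 1 \<in> V" using sub by auto
      then show False using m by force
    qed
    have VU: "V \<in> UL \<Lambda> \<eta>" unfolding UL_eq using V a by (auto simp: mem_clos_iff[of _ "clos \<Lambda>"])
    have "(if bdd_below U then 1 else x) = (if U = V then x else 1)" if "U \<in> UL \<Lambda> \<eta>" for U
    proof (cases "bdd_below U")
      case True then show ?thesis using nb by auto
    next
      case False
      then have "a - 1 \<in> U" using below[OF that] by auto
      then have "U = V" using comps_disjoint[of U _ V] V that unfolding UL_eq by blast
      then show ?thesis using nb by auto
    qed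
    then have "(\<Prod>U\<in>UL \<Lambda> \<eta>. if bdd_below U then 1 else x) = (\<Prod>U\<in>UL \<Lambda> \<eta>. if U = V then x else 1)"
      by (rule prod.cong[OF refl])
    also have "\<dots> = x" using finite_UL[OF fin] VU by (simp add: prod.delta)
    finally show "(\<Prod>U\<in>UL \<Lambda> \<eta>. if bdd_below U then 1 else x) = (if {..<a} \<subseteq> free \<eta> then x else 1)"
      using True by simp
  next
    case False
    have "bdd_below U" if "U \<in> UL \<Lambda> \<eta>" for U
    proof (rule ccontr)
      assume "\<not> bdd_below U"
      from below[OF that this] that False show False unfolding UL_eq comps_iff by blast
    qed
    then show "(\<Prod>U\<in>UL \<Lambda> \<eta>. if bdd_below U then 1 else x) = (if {..<a} \<subseteq> free \<eta> then x else 1)"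
      using False by simp
  qed
qed

text \<open>Mirror image of \<open>prod_UL_unbdd_below\<close>: \<open>a\<close> is now the right
  end of \<open>clos \<Lambda>\<close>, and the half-line lies to its right.\<close>

lemma prod_UL_unbdd_above:
  fixes x :: real
  assumes fin: "finite \<Lambda>" and ne: "\<Lambda> \<noteq> {}"
  shows "(\<Prod>U\<in>UL \<Lambda> \<eta>. if bdd_above U then 1 else x)
    = (if {Max (clos \<Lambda>)<..} \<subseteq> free \<eta> then x else 1)"
proof -
  define a where "a = Max (clos \<Lambda>)"
  have cl: "finite (clos \<Lambda>)" "clos \<Lambda> \<noteq> {}" using fin ne finite_clos by (auto simp: clos_def)
  have a: "a \<in> clos \<Lambda>" using cl a_def by simp
  have below: "{a<..} \<subseteq> U" if asm: "U \<in> UL \<Lambda> \<eta>" "\<not> bdd_above U" for U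
  proof -
    have conv: "iconvex U" "U \<noteq> {}" using that by (auto simp: UL_eq comps_iff)
    obtain u v where u: "u \<in> U" "v \<in> clos \<Lambda>" "\<bar>v - u\<bar> \<le> 1" using asm(1) unfolding UL_def by blast
    then have le: "u \<le> a + 1" using Max_ge[OF cl(1) u(2)] unfolding a_def by linarith
    show ?thesis using conv
      by (cases rule: iconvex_cases) (use asm u le in auto)
  qed
  show ?thesis unfolding a_def[symmetric]
  proof (cases "{a<..} \<subseteq> free \<eta>")
    case True
    then have "a + 1 \<in> free \<eta>" by auto
    then obtain V where V: "V \<in> comps (free \<eta>)" "a + 1 \<in> V" using comps_cover by blast
    have sub: "{a<..} \<subseteq> V" using True unfolding comps_eq[OF V] by auto
    have nb: "\<not> bdd_above V"
    proof
      assume "bdd_above V"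
      then obtain m where m: "\<forall>v\<in>V. v \<le> m" unfolding bdd_above_def by blast
      have "max m a + 1 \<in> V" using sub by auto
      then show False using m by force
    qed
    have VU: "V \<in> UL \<Lambda> \<eta>" unfolding UL_eq using V a by (auto simp: mem_clos_iff[of _ "clos \<Lambda>"])
    have "(if bdd_above U then 1 else x) = (if U = V then x else 1)" if "U \<in> UL \<Lambda> \<eta>" for U
    proof (cases "bdd_above U")
      case True then show ?thesis using nb by auto
    next
      case False
      then have "a + 1 \<in> U" using below[OF that] by auto
      then have "U = V" using comps_disjoint[of U _ V] V that unfolding UL_eq by blast
      then show ?thesis using nb by auto
    qed
    then have "(\<Prod>U\<in>UL \<Lambda> \<eta>. if bdd_above U then 1 else x) = (\<Prod>U\<in>UL \<Lambda> \<eta>. if U = V then x else 1)"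
      by (rule prod.cong[OF refl])
    also have "\<dots> = x" using finite_UL[OF fin] VU by (simp add: prod.delta)
    finally show "(\<Prod>U\<in>UL \<Lambda> \<eta>. if bdd_above U then 1 else x) = (if {a<..} \<subseteq> free \<eta> then x else 1)"
      using True by simp
  next
    case False
    have "bdd_above U" if "U \<in> UL \<Lambda> \<eta>" for U
    proof (rule ccontr)
      assume "\<not> bdd_above U"
      from below[OF that this] that False show False unfolding UL_eq comps_iff by blast
    qed
    then show "(\<Prod>U\<in>UL \<Lambda> \<eta>. if bdd_above U then 1 else x) = (if {a<..} \<subseteq> free \<eta> then x else 1)"
      using False by simp
  qed
qed

text \<open>Cross-multiplied form of the equality of weight ratios in the two volumes. Passing from
  \<Lambda> to \<Delta> multiplies a weight by contributions of the sites in
  \<open>clos \<Delta> - clos \<Lambda>\<close>, of the components in \<open>R\<close>, and by the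
  factor \<open>k\<close> of the unbounded components; each of these is the same for both
  configurations.\<close>

lemma Wt_volume:
  assumes fin: "finite \<Delta>" and sub: "\<Lambda> \<subseteq> \<Delta>"
    and ag: "\<And>i. i \<notin> \<Lambda> \<Longrightarrow> \<eta> i = \<eta>' i"
  shows "Wt p \<Delta> \<eta> * Wt p \<Lambda> \<eta>' = Wt p \<Delta> \<eta>' * Wt p \<Lambda> \<eta>"
proof (cases "\<Lambda> = {}")
  \<comment> \<open>The ends \<open>Min (clos \<Lambda>)\<close> and
    \<open>Max (clos \<Lambda>)\<close> are meaningless for empty \<Lambda>, but then the two
    configurations coincide.\<close>
  case True
  then have "\<eta> = \<eta>'" using ag by auto
  then show ?thesis by simp
next
  case ne: False
  have finL: "finite \<Lambda>" using fin sub finite_subset by blast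
  have cl: "finite (clos \<Delta>)" "finite (clos \<Lambda>)" "clos \<Lambda> \<subseteq> clos \<Delta>"
    using fin finL sub finite_clos clos_mono by auto
  define R where "R = UL \<Delta> \<eta> - UL \<Lambda> \<eta>"
  have R': "R = UL \<Delta> \<eta>' - UL \<Lambda> \<eta>'" unfolding R_def by (rule UL_diff_agree[OF ag])
  define l where "l = lamPF p ^ nat (Min (clos \<Lambda>) - Min (clos \<Delta>))"
  define r where "r = lamPF p ^ nat (Max (clos \<Delta>) - Max (clos \<Lambda>))"
  define k where "k \<zeta> = (if {..< Min (clos \<Lambda>)} \<subseteq> free \<zeta> then l else 1)
    * ((if {Max (clos \<Lambda>)<..} \<subseteq> free \<zeta> then r else 1))" for \<zeta>
  have prod: "(\<Prod>U\<in>UL \<Delta> \<zeta>. Zc p \<Delta> U)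
      = (\<Prod>U\<in>UL \<Delta> \<zeta> - UL \<Lambda> \<zeta>. Zc p \<Delta> U) * (k \<zeta> * (\<Prod>U\<in>UL \<Lambda> \<zeta>. Zc p \<Lambda> U))" for \<zeta>
  proof -
    have "(\<Prod>U\<in>UL \<Lambda> \<zeta>. Zc p \<Delta> U)
      = (\<Prod>U\<in>UL \<Lambda> \<zeta>. (if bdd_below U then 1 else l) * ((if bdd_above U then 1 else r) * Zc p \<Lambda> U))"
      by (rule prod.cong[OF refl]) (simp only: l_def r_def Zc_volume[OF fin sub ne])
    also have "\<dots> = k \<zeta> * (\<Prod>U\<in>UL \<Lambda> \<zeta>. Zc p \<Lambda> U)"
      unfolding prod.distrib prod_UL_unbdd_below[OF finL ne] prod_UL_unbdd_above[OF finL ne] k_def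
      by (simp only: ac_simps)
    finally show ?thesis
      by (simp add: prod.subset_diff[OF UL_mono[OF sub] finite_UL[OF fin]])
  qed
  \<comment> \<open>Both half-lines avoid \<open>clos \<Lambda>\<close>, so the shared spins decide
    whether they are free.\<close>
  have k: "k \<eta> = k \<eta>'"
  proof -
    have "j \<notin> clos \<Lambda>" if "j < Min (clos \<Lambda>) \<or> Max (clos \<Lambda>) < j" for j
      using that Min_le[OF cl(2), of j] Max_ge[OF cl(2), of j] by linarith
    then have "j \<in> free \<eta> \<longleftrightarrow> j \<in> free \<eta>'" if "j < Min (clos \<Lambda>) \<or> Max (clos \<Lambda>) < j" for j
      using free_agree[of \<Lambda> \<eta> \<eta>', OF ag] that by blast
    then have "{..< Min (clos \<Lambda>)} \<subseteq> free \<eta> \<longleftrightarrow> {..< Min (clos \<Lambda>)} \<subseteq> free \<eta>'"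
      "{Max (clos \<Lambda>)<..} \<subseteq> free \<eta> \<longleftrightarrow> {Max (clos \<Lambda>)<..} \<subseteq> free \<eta>'" by auto
    then show ?thesis unfolding k_def by simp
  qed
  have split: "card (S \<inter> clos \<Delta>) = card (S \<inter> (clos \<Delta> - clos \<Lambda>)) + card (S \<inter> clos \<Lambda>)" for S
  proof -
    have "S \<inter> clos \<Delta> = S \<inter> (clos \<Delta> - clos \<Lambda>) \<union> S \<inter> clos \<Lambda>" using cl by blast
    then have "card (S \<inter> clos \<Delta>) = card (S \<inter> (clos \<Delta> - clos \<Lambda>) \<union> S \<inter> clos \<Lambda>)" by (rule arg_cong)
    also have "\<dots> = card (S \<inter> (clos \<Delta> - clos \<Lambda>)) + card (S \<inter> clos \<Lambda>)"
      by (rule card_Un_disjoint) (use cl in auto)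
    finally show ?thesis .
  qed
  \<comment> \<open>A site off \<open>clos \<Lambda>\<close> and its two neighbours all lie outside
    \<Lambda>.\<close>
  have T: "Theta \<eta> \<inter> (clos \<Delta> - clos \<Lambda>) = Theta \<eta>' \<inter> (clos \<Delta> - clos \<Lambda>)"
    "bdry (Theta \<eta>) \<inter> (clos \<Delta> - clos \<Lambda>) = bdry (Theta \<eta>') \<inter> (clos \<Delta> - clos \<Lambda>)"
    using ag by (auto simp: Theta_def mem_bdry_iff mem_clos_iff)
  show ?thesis
    unfolding Wt_def prod split power_add R_def[symmetric] R'[symmetric] k T
    by (simp only: ac_simps)
qed

section \<open>The specification\<close>

text \<open>An occupied neighbour of a surviving site survives too, so thinning leaves no isolated
  site; conversely a configuration without isolated sites is fixed by \<open>thin\<close>.\<close>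

lemma Omega'_eq: "Omega' = {\<eta>. \<forall>i. \<eta> i \<longrightarrow> \<eta> (i - 1) \<or> \<eta> (i + 1)}"
proof (intro set_eqI iffI)
  fix \<eta> assume "\<eta> \<in> Omega'"
  then show "\<eta> \<in> {\<eta>. \<forall>i. \<eta> i \<longrightarrow> \<eta> (i - 1) \<or> \<eta> (i + 1)}"
    unfolding Omega'_def by (auto simp: thin_def)
next
  fix \<eta> :: cfg assume "\<eta> \<in> {\<eta>. \<forall>i. \<eta> i \<longrightarrow> \<eta> (i - 1) \<or> \<eta> (i + 1)}"
  then have "\<eta> = thin \<eta>" by (auto simp: thin_def)
  then show "\<eta> \<in> Omega'" unfolding Omega'_def by (metis rangeI)
qed

lemma thin_in_Omega': "thin \<omega> \<in> Omega'"
  by (simp add: Omega'_def)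

lemma space_OmegaM [simp]: "space OmegaM = UNIV"
  by (auto simp: OmegaM_def space_PiM)

lemma measurable_spin [measurable]: "(\<lambda>\<omega>. \<omega> i) \<in> measurable OmegaM (count_space UNIV)"
  unfolding OmegaM_def by (rule measurable_component_singleton) simp

lemma measurable_OmegaM_I:
  assumes "\<And>i. (\<lambda>x. f x i) \<in> measurable M (count_space UNIV)"
  shows "f \<in> measurable M OmegaM"
  unfolding OmegaM_def by (rule measurable_PiM_single') (use assms in auto)

lemma Omega'_sets [measurable]: "Omega' \<in> sets OmegaM"
proof -
  have "Measurable.pred OmegaM (\<lambda>\<eta>. \<forall>i. \<eta> i \<longrightarrow> \<eta> (i - 1) \<or> \<eta> (i + 1))" by measurable
  then have "{\<eta> \<in> space OmegaM. \<forall>i. \<eta> i \<longrightarrow> \<eta> (i - 1) \<or> \<eta> (i + 1)} \<in> sets OmegaM" by (rule predE)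
  then show ?thesis by (simp add: Omega'_eq)
qed

lemma space_F' [simp]: "space F' = Omega'"
  by (simp add: F'_def space_restrict_space)

lemma sets_F'_iff: "B \<in> sets F' \<longleftrightarrow> B \<in> sets OmegaM \<and> B \<subseteq> Omega'"
  unfolding F'_def by (subst sets_restrict_space_iff) auto

lemma measurable_thin: "thin \<in> measurable OmegaM F'"
  unfolding F'_def
proof (rule measurable_restrict_space2)
  show "thin \<in> measurable OmegaM OmegaM"
    by (rule measurable_OmegaM_I) (unfold thin_def, measurable)
qed (use thin_in_Omega' in auto)

lemma space_F_spins [simp]: "space (F_spins \<Delta>) = UNIV"
  by (simp add: F_spins_def)

lemma space_F'_spins [simp]: "space (F'_spins \<Delta>) = Omega'"
  by (simp add: F'_spins_def space_restrict_space)

lemma measurable_spin_F_spins: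
  assumes "i \<in> \<Delta>" shows "(\<lambda>\<omega>. \<omega> i) \<in> measurable (F_spins \<Delta>) (count_space UNIV)"
proof -
  have 1: "(\<lambda>\<omega>. restrict \<omega> \<Delta>) \<in> measurable (F_spins \<Delta>) (PiM \<Delta> (\<lambda>_. count_space UNIV))"
    unfolding F_spins_def by (rule measurable_vimage_algebra1) (auto simp: space_PiM)
  have "(\<lambda>\<omega>. restrict \<omega> \<Delta> i) \<in> measurable (F_spins \<Delta>) (count_space UNIV)"
    by (rule measurable_compose[OF 1 measurable_component_singleton[OF assms]])
  then show ?thesis using assms by simp
qed

text \<open>Measurability of the identity encodes that the events of
  \<open>F'_spins \<Delta>\<close> belong to \<open>F'\<close>, in a form that composes with other
  measurable maps.\<close>

lemma measurable_id_F'_spins: "(\<lambda>\<omega>. \<omega>) \<in> measurable F' (F'_spins \<Delta>)"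
proof -
  have "(\<lambda>\<omega>. restrict \<omega> \<Delta>) \<in> measurable OmegaM (PiM \<Delta> (\<lambda>_. count_space UNIV))"
    by (rule measurable_restrict) (rule measurable_spin)
  then have "(\<lambda>\<omega>. \<omega>) \<in> measurable OmegaM (F_spins \<Delta>)"
    unfolding F_spins_def by (intro measurable_vimage_algebra2) auto
  then show ?thesis unfolding F'_def F'_spins_def
    by (intro measurable_restrict_space2 measurable_restrict_space1) (auto simp: space_restrict_space)
qed

lemma sets_F'_spins_subset: "A \<in> sets (F'_spins \<Delta>) \<Longrightarrow> A \<in> sets F'"
proof -
  assume A: "A \<in> sets (F'_spins \<Delta>)"
  then have "A \<subseteq> Omega'" using sets.sets_into_space[OF A] by simp
  then have "(\<lambda>\<omega>. \<omega>) -` A \<inter> space F' = A" by auto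
  then show "A \<in> sets F'" using measurable_sets[OF measurable_id_F'_spins A] by simp
qed

text \<open>Such an event is the trace of a preimage under restriction to \<Delta>, so it cannot
  separate configurations with equal restrictions. Properness of the kernels rests on this.\<close>

lemma F'_spins_invariant:
  assumes A: "A \<in> sets (F'_spins \<Delta>)" and "\<omega> \<in> Omega'" "\<eta> \<in> Omega'"
    and ag: "\<And>i. i \<in> \<Delta> \<Longrightarrow> \<omega> i = \<eta> i"
  shows "\<omega> \<in> A \<longleftrightarrow> \<eta> \<in> A"
proof -
  obtain A' where A': "A' \<in> sets (F_spins \<Delta>)" "A = A' \<inter> Omega'"
    using A unfolding F'_spins_def sets_restrict_space by auto
  then obtain S where S: "A' = (\<lambda>\<omega>. restrict \<omega> \<Delta>) -` S \<inter> space OmegaM"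
    unfolding F_spins_def by (auto simp: sets_vimage_algebra2 space_PiM)
  have "restrict \<omega> \<Delta> = restrict \<eta> \<Delta>" using ag by (intro restrict_ext)
  then show ?thesis using assms(2,3) A'(2) S by auto
qed

text \<open>The spins in \<Lambda> are encoded as a subset \<open>X\<close>, so that sums over
  \<Lambda>-configurations run over \<open>Pow \<Lambda>\<close>, an index set that does not depend
  on \<omega>. The same map later redraws Bernoulli spins.\<close>

definition mrg :: "int set \<Rightarrow> int set \<Rightarrow> cfg \<Rightarrow> cfg" where
  "mrg \<Lambda> X \<omega> = (\<lambda>i. if i \<in> \<Lambda> then i \<in> X else \<omega> i)"

lemma Conf_eq_mrg: "Conf \<Lambda> \<omega> = {\<eta> \<in> (\<lambda>X. mrg \<Lambda> X \<omega>) ` Pow \<Lambda>. \<eta> \<in> Omega'}"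
proof (intro set_eqI iffI)
  fix \<eta> assume h: "\<eta> \<in> Conf \<Lambda> \<omega>"
  then have "\<eta> = mrg \<Lambda> {i \<in> \<Lambda>. \<eta> i} \<omega>" by (auto simp: Conf_def mrg_def)
  then show "\<eta> \<in> {\<eta> \<in> (\<lambda>X. mrg \<Lambda> X \<omega>) ` Pow \<Lambda>. \<eta> \<in> Omega'}" using h by (auto simp: Conf_def)
qed (auto simp: Conf_def mrg_def)

lemma inj_mrg: "inj_on (\<lambda>X. mrg \<Lambda> X \<omega>) (Pow \<Lambda>)"
proof (rule inj_onI)
  fix X Y assume h: "X \<in> Pow \<Lambda>" "Y \<in> Pow \<Lambda>" "mrg \<Lambda> X \<omega> = mrg \<Lambda> Y \<omega>"
  have "i \<in> X \<longleftrightarrow> i \<in> Y" if "i \<in> \<Lambda>" for i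
    using fun_cong[OF h(3), of i] that by (simp add: mrg_def)
  then show "X = Y" using h by blast
qed

lemma finite_Conf: "finite \<Lambda> \<Longrightarrow> finite (Conf \<Lambda> \<omega>)"
  unfolding Conf_eq_mrg by simp

lemma Conf_self: "\<omega> \<in> Omega' \<Longrightarrow> \<omega> \<in> Conf \<Lambda> \<omega>"
  by (simp add: Conf_def)

lemma Conf_subset: "Conf \<Lambda> \<omega> \<subseteq> Omega'"
  by (auto simp: Conf_def)

lemma Conf_cong: "\<eta> \<in> Conf \<Lambda> \<omega> \<Longrightarrow> Conf \<Lambda> \<eta> = Conf \<Lambda> \<omega>"
  by (auto simp: Conf_def)

lemma Zpart_cong: "\<eta> \<in> Conf \<Lambda> \<omega> \<Longrightarrow> Zpart p \<Lambda> \<eta> = Zpart p \<Lambda> \<omega>"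
  by (simp add: Zpart_def Conf_cong)

lemma Zpart_pos:
  assumes "0 < p" "p < 1" "finite \<Lambda>" "\<omega> \<in> Omega'"
  shows "0 < Zpart p \<Lambda> \<omega>"
  unfolding Zpart_def using assms Conf_self[of \<omega> \<Lambda>]
  by (intro sum_pos Wt_pos finite_Conf) auto

text \<open>\<open>measure_of\<close> takes the prescribed values only once the set function is
  known to be a measure. A weighted point measure on the finite set
  \<open>Conf \<Lambda> \<omega>\<close>, pushed forward to \<open>F'\<close>, has these values,
  which settles additivity.\<close>

lemma gamma'_eq:
  assumes p: "0 < p" "p < 1" and fin: "finite \<Lambda>" and \<omega>: "\<omega> \<in> Omega'"
  shows "gamma' p \<Lambda> \<omega> =
    distr (point_measure (Conf \<Lambda> \<omega>) (\<lambda>\<eta>. ennreal (Wt p \<Lambda> \<eta> / Zpart p \<Lambda> \<omega>))) F' (\<lambda>\<eta>. \<eta>)"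
    (is "_ = ?N")
proof -
  have meas: "(\<lambda>\<eta>. \<eta>) \<in> measurable (point_measure (Conf \<Lambda> \<omega>) f) F'" for f
    by (auto simp: measurable_def space_point_measure sets_point_measure Conf_def)
  have val: "ennreal ((\<Sum>\<eta>\<in>Conf \<Lambda> \<omega> \<inter> B. Wt p \<Lambda> \<eta>) / Zpart p \<Lambda> \<omega>) = emeasure ?N B" if "B \<in> sets F'" for B
  proof -
    have "(\<lambda>\<eta>. \<eta>) -` B \<inter> space (point_measure (Conf \<Lambda> \<omega>) f) = Conf \<Lambda> \<omega> \<inter> B" for f
      by (auto simp: space_point_measure)
    then have "emeasure ?N B = (\<Sum>\<eta>\<in>Conf \<Lambda> \<omega> \<inter> B. ennreal (Wt p \<Lambda> \<eta> / Zpart p \<Lambda> \<omega>))"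
      using that fin by (simp add: emeasure_distr[OF meas] emeasure_point_measure_finite finite_Conf)
    also have "\<dots> = ennreal (\<Sum>\<eta>\<in>Conf \<Lambda> \<omega> \<inter> B. Wt p \<Lambda> \<eta> / Zpart p \<Lambda> \<omega>)"
      using Wt_pos[OF p] Zpart_pos[OF p fin \<omega>] by (intro sum_ennreal) (simp add: less_imp_le)
    finally show ?thesis by (simp add: sum_divide_distrib)
  qed
  \<comment> \<open>\<open>measure_of\<close> depends on the set function only through its values on
    measurable sets.\<close>
  have "gamma' p \<Lambda> \<omega> = measure_of Omega' (sets F') (emeasure ?N)"
    unfolding gamma'_def
    by (rule measure_of_eq) (auto simp: sets_F'_iff val sets.sigma_sets_eq[of F', simplified])
  also have "\<dots> = ?N" using measure_of_of_measure[of ?N] by simp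
  finally show ?thesis .
qed

lemma sets_gamma':
  assumes "0 < p" "p < 1" "finite \<Lambda>" "\<omega> \<in> Omega'" shows "sets (gamma' p \<Lambda> \<omega>) = sets F'"
  by (simp add: gamma'_eq[OF assms])

lemma nn_integral_gamma':
  assumes p: "0 < p" "p < 1" and fin: "finite \<Lambda>" and \<omega>: "\<omega> \<in> Omega'"
    and f: "f \<in> borel_measurable F'"
  shows "(\<integral>\<^sup>+\<eta>. f \<eta> \<partial>gamma' p \<Lambda> \<omega>) = (\<Sum>\<eta>\<in>Conf \<Lambda> \<omega>. ennreal (Wt p \<Lambda> \<eta> / Zpart p \<Lambda> \<omega>) * f \<eta>)"
proof -
  have meas: "(\<lambda>\<eta>. \<eta>) \<in> measurable (point_measure (Conf \<Lambda> \<omega>) f) F'" for f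
    by (auto simp: measurable_def space_point_measure sets_point_measure Conf_def)
  show ?thesis unfolding gamma'_eq[OF p fin \<omega>]
    by (subst nn_integral_distr[OF meas])
      (use f fin in \<open>auto simp: nn_integral_point_measure_finite finite_Conf\<close>)
qed

lemma emeasure_gamma':
  assumes p: "0 < p" "p < 1" and fin: "finite \<Lambda>" and \<omega>: "\<omega> \<in> Omega'" and B: "B \<in> sets F'"
  shows "emeasure (gamma' p \<Lambda> \<omega>) B = (\<Sum>\<eta>\<in>Conf \<Lambda> \<omega>. ennreal (Wt p \<Lambda> \<eta> / Zpart p \<Lambda> \<omega>) * indicator B \<eta>)"
proof -
  have "emeasure (gamma' p \<Lambda> \<omega>) B = (\<integral>\<^sup>+\<eta>. indicator B \<eta> \<partial>gamma' p \<Lambda> \<omega>)"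
    using B by (simp add: sets_gamma'[OF p fin \<omega>])
  also have "\<dots> = (\<Sum>\<eta>\<in>Conf \<Lambda> \<omega>. ennreal (Wt p \<Lambda> \<eta> / Zpart p \<Lambda> \<omega>) * indicator B \<eta>)"
    by (rule nn_integral_gamma'[OF p fin \<omega>]) (use B in measurable)
  finally show ?thesis .
qed

lemma gamma'_total:
  assumes p: "0 < p" "p < 1" and fin: "finite \<Lambda>" and \<omega>: "\<omega> \<in> Omega'"
  shows "(\<Sum>\<eta>\<in>Conf \<Lambda> \<omega>. ennreal (Wt p \<Lambda> \<eta> / Zpart p \<Lambda> \<omega>)) = 1"
proof -
  have "(\<Sum>\<eta>\<in>Conf \<Lambda> \<omega>. ennreal (Wt p \<Lambda> \<eta> / Zpart p \<Lambda> \<omega>)) = ennreal (\<Sum>\<eta>\<in>Conf \<Lambda> \<omega>. Wt p \<Lambda> \<eta> / Zpart p \<Lambda> \<omega>)"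
    using Wt_pos[OF p] Zpart_pos[OF p fin \<omega>] by (intro sum_ennreal) (simp add: less_imp_le)
  also have "(\<Sum>\<eta>\<in>Conf \<Lambda> \<omega>. Wt p \<Lambda> \<eta> / Zpart p \<Lambda> \<omega>) = 1"
    using Zpart_pos[OF p fin \<omega>] by (simp add: sum_divide_distrib[symmetric] Zpart_def)
  finally show ?thesis by simp
qed

lemma prob_space_gamma':
  assumes p: "0 < p" "p < 1" and fin: "finite \<Lambda>" and \<omega>: "\<omega> \<in> Omega'"
  shows "prob_space (gamma' p \<Lambda> \<omega>)"
proof (rule prob_spaceI)
  have "emeasure (gamma' p \<Lambda> \<omega>) (space F') = (\<Sum>\<eta>\<in>Conf \<Lambda> \<omega>. ennreal (Wt p \<Lambda> \<eta> / Zpart p \<Lambda> \<omega>))"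
    using Conf_subset[of \<Lambda> \<omega>]
    by (subst emeasure_gamma'[OF assms sets.top]) (auto intro!: sum.cong simp: indicator_def)
  then show "emeasure (gamma' p \<Lambda> \<omega>) (space (gamma' p \<Lambda> \<omega>)) = 1"
    unfolding gamma'_total[OF assms] sets_eq_imp_space_eq[OF sets_gamma'[OF assms]] .
qed

text \<open>All configurations of \<open>Conf \<Lambda> \<omega>\<close> agree with \<omega> off
  \<Lambda>, so the indicator of \<open>A\<close> is constant there and leaves the sum. The version
  with an additional event \<open>B\<close> is the one needed for the DLR equations.\<close>

lemma gamma'_proper:
  assumes p: "0 < p" "p < 1" and fin: "finite \<Lambda>" and \<omega>: "\<omega> \<in> Omega'"
    and A: "A \<in> sets (F'_spins (- \<Lambda>))" and B: "B \<in> sets F'"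
  shows "emeasure (gamma' p \<Lambda> \<omega>) (A \<inter> B) = indicator A \<omega> * emeasure (gamma' p \<Lambda> \<omega>) B"
proof -
  have A': "A \<in> sets F'" using A by (rule sets_F'_spins_subset)
  have "indicator (A \<inter> B) \<eta> = (indicator A \<omega> * indicator B \<eta> :: ennreal)" if "\<eta> \<in> Conf \<Lambda> \<omega>" for \<eta>
    using F'_spins_invariant[OF A \<omega>, of \<eta>] that unfolding Conf_def by (auto simp: indicator_def)
  then show ?thesis
    unfolding emeasure_gamma'[OF p fin \<omega> B] emeasure_gamma'[OF p fin \<omega> sets.Int[OF A' B]] sum_distrib_left
    by (intro sum.cong refl) (simp add: ac_simps)
qed

lemma gamma'_proper_indicator:
  assumes p: "0 < p" "p < 1" and fin: "finite \<Lambda>" and \<omega>: "\<omega> \<in> Omega'"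
    and A: "A \<in> sets (F'_spins (- \<Lambda>))"
  shows "emeasure (gamma' p \<Lambda> \<omega>) A = indicator A \<omega>"
proof -
  interpret prob_space "gamma' p \<Lambda> \<omega>" by (rule prob_space_gamma'[OF p fin \<omega>])
  have "emeasure (gamma' p \<Lambda> \<omega>) (space F') = 1"
    using emeasure_space_1 sets_eq_imp_space_eq[OF sets_gamma'[OF p fin \<omega>]] by simp
  moreover have "A \<inter> space F' = A" using sets.sets_into_space[OF A] by auto
  ultimately show ?thesis using gamma'_proper[OF p fin \<omega> A sets.top] by simp
qed

section \<open>Measurability of the kernels\<close>

definition int_intervals :: "int set set" where
  "int_intervals = (\<lambda>(a, b). {a..b}) ` UNIV \<union> range atMost \<union> range atLeast \<union> {UNIV}"

lemma countable_int_intervals: "countable int_intervals"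
  unfolding int_intervals_def by auto

lemma UL_in_intervals: "UL \<Lambda> \<eta> \<subseteq> int_intervals"
proof
  fix U assume "U \<in> UL \<Lambda> \<eta>"
  then have "iconvex U" "U \<noteq> {}" by (auto simp: UL_eq comps_iff)
  then show "U \<in> int_intervals"
    by (cases rule: iconvex_cases) (auto simp: int_intervals_def)
qed

text \<open>The finitely many components near \<open>\<Lambda>\<close> range over a countable set, so only preimages of points matter.\<close>

lemma measurable_UL:
  assumes fin: "finite \<Lambda>"
  shows "UL \<Lambda> \<in> measurable OmegaM (count_space {\<V>. finite \<V> \<and> \<V> \<subseteq> int_intervals})"
proof -
  have cnt: "countable {\<V>. finite \<V> \<and> \<V> \<subseteq> int_intervals}"
    by (rule countable_Collect_finite_subset[OF countable_int_intervals])
  have UL: "{\<eta>. U \<in> UL \<Lambda> \<eta>} \<in> sets OmegaM" for U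
  proof -
    \<comment> \<open>For fixed \<open>U\<close> the first bracket is a constant truth value, and
      the rest is a countable conjunction of conditions on finitely many spins each.\<close>
    have eq: "U \<in> UL \<Lambda> \<eta> \<longleftrightarrow> (U \<noteq> {} \<and> iconvex U \<and> U \<inter> clos (clos \<Lambda>) \<noteq> {}) \<and>
       (\<forall>j. j \<in> U \<longrightarrow> \<not> \<eta> (j - 1) \<and> \<not> \<eta> j \<and> \<not> \<eta> (j + 1)) \<and>
       (\<forall>j. j \<in> bdry U \<longrightarrow> \<not> (\<not> \<eta> (j - 1) \<and> \<not> \<eta> j \<and> \<not> \<eta> (j + 1)))" for \<eta>
      unfolding UL_eq comps_iff free_def by blast
    have "Measurable.pred OmegaM (\<lambda>\<eta>. U \<in> UL \<Lambda> \<eta>)" unfolding eq by measurable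
    then have "{\<eta> \<in> space OmegaM. U \<in> UL \<Lambda> \<eta>} \<in> sets OmegaM" by (rule predE)
    then show ?thesis by simp
  qed
  show ?thesis unfolding measurable_count_space_eq_countable[OF cnt]
  proof (intro conjI ballI)
    show "UL \<Lambda> \<in> space OmegaM \<rightarrow> {\<V>. finite \<V> \<and> \<V> \<subseteq> int_intervals}"
      using finite_UL[OF fin] UL_in_intervals by auto
  next
    fix \<V> assume V: "\<V> \<in> {\<V>. finite \<V> \<and> \<V> \<subseteq> int_intervals}"
    \<comment> \<open>The value of \<open>UL \<Lambda>\<close> is pinned down by asking, for each of
      the countably many intervals, whether it is a member.\<close>
    have "UL \<Lambda> -` {\<V>} \<inter> space OmegaM
      = space OmegaM \<inter> (\<Inter>U\<in>int_intervals. if U \<in> \<V> then {\<eta>. U \<in> UL \<Lambda> \<eta>} else space OmegaM - {\<eta>. U \<in> UL \<Lambda> \<eta>})"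
      (is "_ = _ \<inter> (\<Inter>U\<in>_. ?f U)")
    proof (intro set_eqI iffI)
      fix \<eta> assume "\<eta> \<in> UL \<Lambda> -` {\<V>} \<inter> space OmegaM"
      then show "\<eta> \<in> space OmegaM \<inter> (\<Inter>U\<in>int_intervals. ?f U)" by auto
    next
      fix \<eta> assume h: "\<eta> \<in> space OmegaM \<inter> (\<Inter>U\<in>int_intervals. ?f U)"
      have "U \<in> UL \<Lambda> \<eta> \<longleftrightarrow> U \<in> \<V>" if "U \<in> int_intervals" for U
      proof -
        have "\<eta> \<in> ?f U" using h that by blast
        then show ?thesis by (auto split: if_splits)
      qed
      then have "UL \<Lambda> \<eta> = \<V>" using V UL_in_intervals by blast
      then show "\<eta> \<in> UL \<Lambda> -` {\<V>} \<inter> space OmegaM" by simp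
    qed
    also have "\<dots> \<in> sets OmegaM"
    proof (intro sets.Int sets.top sets.countable_INT'')
      show "countable int_intervals" by (rule countable_int_intervals)
      fix U show "?f U \<in> sets OmegaM" using UL[of U] sets.compl_sets[OF UL[of U]] by simp
    qed (use sets.top[of OmegaM] in simp)
    finally show "UL \<Lambda> -` {\<V>} \<inter> space OmegaM \<in> sets OmegaM" .
  qed
qed

lemma measurable_Wt:
  assumes fin: "finite \<Lambda>"
  shows "Wt p \<Lambda> \<in> borel_measurable OmegaM"
proof -
  \<comment> \<open>The exponent is a random cardinality; a product over the fixed finite set
    \<open>clos \<Lambda>\<close> has factors that each depend on finitely many spins.\<close>
  have card: "x ^ card (S \<inter> clos \<Lambda>) = (\<Prod>j\<in>clos \<Lambda>. if j \<in> S then x else 1)" for x :: real and S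
  proof -
    have "(\<Prod>j\<in>clos \<Lambda>. if j \<in> S then x else 1) = (\<Prod>j\<in>clos \<Lambda> \<inter> S. x)"
      using finite_clos[OF fin] by (rule prod.inter_restrict[symmetric])
    then show ?thesis by (simp add: Int_commute)
  qed
  have 1: "(\<lambda>\<eta>. (\<Prod>U\<in>UL \<Lambda> \<eta>. Zc p \<Lambda> U)) \<in> borel_measurable OmegaM"
    by (rule measurable_compose[OF measurable_UL[OF fin], of "\<lambda>\<V>. \<Prod>U\<in>\<V>. Zc p \<Lambda> U"]) simp
  have 2: "(\<lambda>\<eta>. \<Prod>j\<in>clos \<Lambda>. if j \<in> Theta \<eta> then p else 1) \<in> borel_measurable OmegaM"
    unfolding Theta_def mem_Collect_eq by measurable
  have 3: "(\<lambda>\<eta>. \<Prod>j\<in>clos \<Lambda>. if j \<in> bdry (Theta \<eta>) then 1 - p else 1) \<in> borel_measurable OmegaM"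
    unfolding mem_bdry_iff Theta_def mem_Collect_eq by measurable
  show ?thesis unfolding Wt_def[abs_def] card
    using 1 2 3 by (intro borel_measurable_times)
qed

text \<open>Inside \<Lambda> the merged spins are constants, and outside they are read from the
  conditioning. Hence everything built from \<open>mrg \<Lambda> X\<close> is measurable with
  respect to the outside spins alone.\<close>

lemma measurable_mrg: "mrg \<Lambda> X \<in> measurable (F'_spins (- \<Lambda>)) OmegaM"
proof (rule measurable_OmegaM_I)
  fix i
  show "(\<lambda>\<omega>. mrg \<Lambda> X \<omega> i) \<in> measurable (F'_spins (- \<Lambda>)) (count_space UNIV)"
    by (cases "i \<in> \<Lambda>")
      (auto simp: mrg_def F'_spins_def intro!: measurable_restrict_space1 measurable_spin_F_spins)
qed

text \<open>The range of summation depends on \<omega>. Moving the constraint into an indicator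
  gives a sum over a fixed finite set, whose terms can be shown measurable one by one.\<close>

lemma sum_Conf:
  fixes g :: "cfg \<Rightarrow> 'a::semiring_1"
  assumes fin: "finite \<Lambda>"
  shows "(\<Sum>\<eta>\<in>Conf \<Lambda> \<omega>. g \<eta>) = (\<Sum>X\<in>Pow \<Lambda>. indicator Omega' (mrg \<Lambda> X \<omega>) * g (mrg \<Lambda> X \<omega>))"
proof -
  have "(\<Sum>X\<in>Pow \<Lambda>. indicator Omega' (mrg \<Lambda> X \<omega>) * g (mrg \<Lambda> X \<omega>))
    = (\<Sum>\<eta>\<in>(\<lambda>X. mrg \<Lambda> X \<omega>) ` Pow \<Lambda>. indicator Omega' \<eta> * g \<eta>)"
    by (simp add: sum.reindex[OF inj_mrg])
  also have "\<dots> = (\<Sum>\<eta>\<in>Conf \<Lambda> \<omega>. indicator Omega' \<eta> * g \<eta>)"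
    by (rule sum.mono_neutral_right) (use fin in \<open>auto simp: Conf_eq_mrg\<close>)
  also have "\<dots> = (\<Sum>\<eta>\<in>Conf \<Lambda> \<omega>. g \<eta>)"
    using Conf_subset by (intro sum.cong) (auto simp: indicator_def)
  finally show ?thesis ..
qed

lemma measurable_gamma':
  assumes p: "0 < p" "p < 1" and fin: "finite \<Lambda>" and B: "B \<in> sets F'"
  shows "(\<lambda>\<omega>. emeasure (gamma' p \<Lambda> \<omega>) B) \<in> borel_measurable (F'_spins (- \<Lambda>))"
proof -
  note [measurable] = measurable_mrg measurable_Wt[OF fin]
  have BO [measurable]: "B \<in> sets OmegaM" using B by (simp add: sets_F'_iff)
  have Z: "Zpart p \<Lambda> \<in> borel_measurable (F'_spins (- \<Lambda>))"
    unfolding Zpart_def[abs_def] sum_Conf[OF fin] by measurable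
  have "(\<lambda>\<omega>. \<Sum>X\<in>Pow \<Lambda>. indicator Omega' (mrg \<Lambda> X \<omega>) *
      (ennreal (Wt p \<Lambda> (mrg \<Lambda> X \<omega>) / Zpart p \<Lambda> \<omega>) * indicator B (mrg \<Lambda> X \<omega>)))
    \<in> borel_measurable (F'_spins (- \<Lambda>))"
    using Z by measurable
  then show ?thesis
    by (rule measurable_cong[THEN iffD2, rotated])
      (simp add: emeasure_gamma'[OF p fin _ B] sum_Conf[OF fin])
qed

lemma measurable_gamma'_F':
  assumes p: "0 < p" "p < 1" and fin: "finite \<Lambda>" and B: "B \<in> sets F'"
  shows "(\<lambda>\<omega>. emeasure (gamma' p \<Lambda> \<omega>) B) \<in> borel_measurable F'"
  by (rule measurable_compose[OF measurable_id_F'_spins measurable_gamma'[OF assms]])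

text \<open>The left side is a sum over pairs in \<open>Conf \<Delta> \<omega>\<close> that agree
  off \<Lambda>. This relation is symmetric, so detailed balance exchanges the two members of a
  pair, and the inner sum becomes the total mass of a \<Lambda>-kernel, which is one.\<close>

lemma gamma'_consistent:
  assumes p: "0 < p" "p < 1" and fin: "finite \<Delta>" and sub: "\<Lambda> \<subseteq> \<Delta>"
    and B: "B \<in> sets F'" and \<omega>: "\<omega> \<in> Omega'"
  shows "(\<integral>\<^sup>+\<eta>. emeasure (gamma' p \<Lambda> \<eta>) B \<partial>(gamma' p \<Delta> \<omega>)) = emeasure (gamma' p \<Delta> \<omega>) B"
proof -
  have finL: "finite \<Lambda>" using fin sub finite_subset by blast
  let ?C = "Conf \<Delta> \<omega>"
  let ?ag = "\<lambda>\<eta> \<zeta>. \<forall>i. i \<notin> \<Lambda> \<longrightarrow> \<zeta> i = (\<eta> i :: bool)"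
  have C: "Conf \<Lambda> \<eta> = {\<zeta> \<in> ?C. ?ag \<eta> \<zeta>}" "\<eta> \<in> Omega'" if "\<eta> \<in> ?C" for \<eta>
    using that sub by (auto simp: Conf_def)
  let ?w = "\<lambda>\<Lambda> \<eta> \<omega>. ennreal (Wt p \<Lambda> \<eta> / Zpart p \<Lambda> \<omega>)"
  \<comment> \<open>Detailed balance: this is \<open>Wt_volume\<close> after normalisation, the
    partition function in \<Lambda> being the same for \<eta> and \<zeta>.\<close>
  have sw: "?w \<Delta> \<eta> \<omega> * ?w \<Lambda> \<zeta> \<eta> = ?w \<Delta> \<zeta> \<omega> * ?w \<Lambda> \<eta> \<zeta>" if "\<eta> \<in> ?C" "\<zeta> \<in> ?C" "?ag \<eta> \<zeta>" for \<eta> \<zeta>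
  proof -
    have "\<zeta> \<in> Conf \<Lambda> \<eta>" using that C by blast
    then have Z: "Zpart p \<Lambda> \<zeta> = Zpart p \<Lambda> \<eta>" by (rule Zpart_cong)
    have "Wt p \<Delta> \<eta> * Wt p \<Lambda> \<zeta> = Wt p \<Delta> \<zeta> * Wt p \<Lambda> \<eta>"
      by (rule Wt_volume[OF fin sub]) (use that in auto)
    then show ?thesis
      unfolding Z using Wt_pos[OF p] Zpart_pos[OF p fin \<omega>] Zpart_pos[OF p finL C(2)[OF that(1)]]
      by (simp add: ennreal_mult[symmetric] less_imp_le)
  qed
  have "(\<integral>\<^sup>+\<eta>. emeasure (gamma' p \<Lambda> \<eta>) B \<partial>(gamma' p \<Delta> \<omega>))
    = (\<Sum>\<eta>\<in>?C. ?w \<Delta> \<eta> \<omega> * emeasure (gamma' p \<Lambda> \<eta>) B)"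
    by (rule nn_integral_gamma'[OF p fin \<omega> measurable_gamma'_F'[OF p finL B]])
  also have "\<dots> = (\<Sum>\<eta>\<in>?C. \<Sum>\<zeta> | \<zeta> \<in> ?C \<and> ?ag \<eta> \<zeta>. ?w \<Delta> \<zeta> \<omega> * ?w \<Lambda> \<eta> \<zeta> * indicator B \<zeta>)"
  proof (rule sum.cong[OF refl])
    fix \<eta> assume e: "\<eta> \<in> ?C"
    show "?w \<Delta> \<eta> \<omega> * emeasure (gamma' p \<Lambda> \<eta>) B
      = (\<Sum>\<zeta> | \<zeta> \<in> ?C \<and> ?ag \<eta> \<zeta>. ?w \<Delta> \<zeta> \<omega> * ?w \<Lambda> \<eta> \<zeta> * indicator B \<zeta>)"
      unfolding emeasure_gamma'[OF p finL C(2)[OF e] B] C(1)[OF e] sum_distrib_left mult.assoc[symmetric]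
      by (intro sum.cong refl) (use sw[OF e] in simp)
  qed
  also have "\<dots> = (\<Sum>\<zeta>\<in>?C. \<Sum>\<eta> | \<eta> \<in> ?C \<and> ?ag \<eta> \<zeta>. ?w \<Delta> \<zeta> \<omega> * ?w \<Lambda> \<eta> \<zeta> * indicator B \<zeta>)"
    by (rule sum.swap_restrict) (use finite_Conf[OF fin] in auto)
  also have "\<dots> = (\<Sum>\<zeta>\<in>?C. ?w \<Delta> \<zeta> \<omega> * indicator B \<zeta>)"
  proof (rule sum.cong[OF refl])
    fix \<zeta> assume z: "\<zeta> \<in> ?C"
    have "{\<eta>. \<eta> \<in> ?C \<and> ?ag \<eta> \<zeta>} = Conf \<Lambda> \<zeta>" using C(1)[OF z] by auto
    then have "(\<Sum>\<eta> | \<eta> \<in> ?C \<and> ?ag \<eta> \<zeta>. ?w \<Delta> \<zeta> \<omega> * ?w \<Lambda> \<eta> \<zeta> * indicator B \<zeta>)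
      = ?w \<Delta> \<zeta> \<omega> * (\<Sum>\<eta>\<in>Conf \<Lambda> \<zeta>. ?w \<Lambda> \<eta> \<zeta>) * indicator B \<zeta>"
      by (simp only: sum_distrib_left sum_distrib_right)
    also have "\<dots> = ?w \<Delta> \<zeta> \<omega> * indicator B \<zeta>"
      unfolding gamma'_total[OF p finL C(2)[OF z]] by simp
    finally show "(\<Sum>\<eta> | \<eta> \<in> ?C \<and> ?ag \<eta> \<zeta>. ?w \<Delta> \<zeta> \<omega> * ?w \<Lambda> \<eta> \<zeta> * indicator B \<zeta>)
      = ?w \<Delta> \<zeta> \<omega> * indicator B \<zeta>" .
  qed
  also have "\<dots> = emeasure (gamma' p \<Delta> \<omega>) B" by (rule emeasure_gamma'[OF p fin \<omega> B, symmetric])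
  finally show ?thesis .
qed

lemma is_specification_gamma':
  assumes p: "0 < p" "p < 1" shows "is_specification (gamma' p)"
  unfolding is_specification_def
proof (intro conjI allI impI ballI)
  fix \<Lambda> :: "int set" and \<omega> assume h: "finite \<Lambda>" "\<omega> \<in> Omega'"
  show "prob_space (gamma' p \<Lambda> \<omega>)" by (rule prob_space_gamma'[OF p h])
  show "sets (gamma' p \<Lambda> \<omega>) = sets F'" by (rule sets_gamma'[OF p h])
next
  fix \<Lambda> :: "int set" and B assume h: "finite \<Lambda>" "B \<in> sets F'"
  show "(\<lambda>\<omega>. emeasure (gamma' p \<Lambda> \<omega>) B) \<in> borel_measurable (F'_spins (- \<Lambda>))"
    by (rule measurable_gamma'[OF p h])
next
  fix \<Lambda> :: "int set" and B \<omega> assume h: "finite \<Lambda>" "B \<in> sets (F'_spins (- \<Lambda>))" "\<omega> \<in> Omega'"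
  show "emeasure (gamma' p \<Lambda> \<omega>) B = indicator B \<omega>"
    by (rule gamma'_proper_indicator[OF p h(1,3,2)])
next
  fix \<Lambda> \<Delta> :: "int set" and B \<omega> assume "finite \<Delta> \<and> \<Lambda> \<subseteq> \<Delta>" "B \<in> sets F'" "\<omega> \<in> Omega'"
  then show "(\<integral>\<^sup>+\<eta>. emeasure (gamma' p \<Lambda> \<eta>) B \<partial>(gamma' p \<Delta> \<omega>)) = emeasure (gamma' p \<Delta> \<omega>) B"
    by (intro gamma'_consistent[OF p]) auto
qed

section \<open>Hard-core sums\<close>

definition hardcore :: "int set \<Rightarrow> bool" where
  "hardcore Y \<longleftrightarrow> (\<forall>i\<in>Y. i + 1 \<notin> Y)"

text \<open>For finite \<open>S\<close> and \<open>Y \<subseteq> S\<close>, the Bernoulli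
  probability that the occupied sites in \<open>S\<close> are exactly those of
  \<open>Y\<close>.\<close>

definition bern_wt :: "real \<Rightarrow> int set \<Rightarrow> int set \<Rightarrow> real" where
  "bern_wt p S Y = p ^ card Y * (1 - p) ^ card (S - Y)"

text \<open>For finite \<open>S\<close>, the probability that no two neighbouring sites of
  \<open>S\<close> are both occupied.\<close>

definition hc_sum :: "real \<Rightarrow> int set \<Rightarrow> real" where
  "hc_sum p S = (\<Sum>Y\<in>{Y \<in> Pow S. hardcore Y}. bern_wt p S Y)"

lemma hardcore_Un:
  assumes "\<And>s. s \<in> S \<Longrightarrow> s + 1 \<notin> T \<and> s - 1 \<notin> T" "Y \<subseteq> S" "Z \<subseteq> T"
  shows "hardcore (Y \<union> Z) \<longleftrightarrow> hardcore Y \<and> hardcore Z"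
proof -
  have 1: "y + 1 \<notin> Z" if "y \<in> Y" for y using assms that by blast
  have 2: "z + 1 \<notin> Y" if "z \<in> Z" for z
  proof
    assume "z + 1 \<in> Y"
    then have "z + 1 - 1 \<notin> T" using assms by blast
    then show False using that assms by auto
  qed
  show ?thesis unfolding hardcore_def using 1 2 by blast
qed

text \<open>With no adjacency between \<open>S\<close> and \<open>T\<close>, the hard-core
  constraint splits into one constraint on each part, and the Bernoulli weights multiply.\<close>

lemma hc_sum_Un:
  assumes fin: "finite S" "finite T" and dis: "S \<inter> T = {}"
    and adj: "\<And>s. s \<in> S \<Longrightarrow> s + 1 \<notin> T \<and> s - 1 \<notin> T"
  shows "hc_sum p (S \<union> T) = hc_sum p S * hc_sum p T"
proof -
  have "hc_sum p S * hc_sum p T = (\<Sum>(Y, Z)\<in>{Y \<in> Pow S. hardcore Y} \<times> {Y \<in> Pow T. hardcore Y}.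
      bern_wt p S Y * bern_wt p T Z)"
    unfolding hc_sum_def sum_product by (rule sum.cartesian_product)
  also have "\<dots> = hc_sum p (S \<union> T)"
    unfolding hc_sum_def
  proof (rule sum.reindex_bij_witness[where i="\<lambda>W. (W \<inter> S, W \<inter> T)" and j="\<lambda>(Y, Z). Y \<union> Z"])
    fix a assume a: "a \<in> {Y \<in> Pow S. hardcore Y} \<times> {Y \<in> Pow T. hardcore Y}"
    then obtain Y Z where YZ: "a = (Y, Z)" "Y \<subseteq> S" "Z \<subseteq> T" "hardcore Y" "hardcore Z" by auto
    show "((case a of (Y, Z) \<Rightarrow> Y \<union> Z) \<inter> S, (case a of (Y, Z) \<Rightarrow> Y \<union> Z) \<inter> T) = a"
      using YZ dis by auto
    show "(case a of (Y, Z) \<Rightarrow> Y \<union> Z) \<in> {Y \<in> Pow (S \<union> T). hardcore Y}"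
      using YZ hardcore_Un[of S T Y Z, OF adj] by auto
    have "card (Y \<union> Z) = card Y + card Z"
      by (rule card_Un_disjoint) (use YZ fin dis in \<open>auto intro: finite_subset\<close>)
    moreover have "S \<union> T - (Y \<union> Z) = (S - Y) \<union> (T - Z)" using YZ dis by blast
    moreover have "card ((S - Y) \<union> (T - Z)) = card (S - Y) + card (T - Z)"
      by (rule card_Un_disjoint) (use fin dis in auto)
    ultimately show "bern_wt p (S \<union> T) (case a of (Y, Z) \<Rightarrow> Y \<union> Z)
      = (case a of (Y, Z) \<Rightarrow> bern_wt p S Y * bern_wt p T Z)"
      using YZ by (simp add: bern_wt_def power_add)
  next
    fix W assume W: "W \<in> {Y \<in> Pow (S \<union> T). hardcore Y}"
    then have e: "(W \<inter> S) \<union> (W \<inter> T) = W" by blast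
    then show "(case (W \<inter> S, W \<inter> T) of (Y, Z) \<Rightarrow> Y \<union> Z) = W" by simp
    show "(W \<inter> S, W \<inter> T) \<in> {Y \<in> Pow S. hardcore Y} \<times> {Y \<in> Pow T. hardcore Y}"
      using W by (auto simp: hardcore_def)
  qed
  finally show ?thesis ..
qed

text \<open>Distinct components are disjoint and never adjacent: a site of one next to another would
  be a boundary site lying in \<open>F\<close>, against maximality.\<close>

lemma hc_sum_Union_comps:
  assumes "finite \<U>" "\<And>U. U \<in> \<U> \<Longrightarrow> finite U" "\<U> \<subseteq> comps F"
  shows "hc_sum p (\<Union>\<U>) = (\<Prod>U\<in>\<U>. hc_sum p U)"
  using assms
proof (induction \<U> rule: finite_induct)
  case empty
  have "{Y \<in> Pow {}. hardcore Y} = {{}}" by (auto simp: hardcore_def)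
  then show ?case by (simp add: hc_sum_def bern_wt_def)
next
  case (insert U \<U>)
  have adj: "s + 1 \<notin> \<Union>\<U> \<and> s - 1 \<notin> \<Union>\<U>" if s: "s \<in> U" for s
  proof -
    have "t \<notin> \<Union>\<U>" if t: "t = s + 1 \<or> t = s - 1" for t
    proof
      assume "t \<in> \<Union>\<U>"
      then obtain V where V: "V \<in> \<U>" "t \<in> V" by blast
      then have c: "V \<in> comps F" "U \<in> comps F" "U \<noteq> V" using insert by auto
      then have "t \<notin> U" using comps_disjoint[of U F V] V by blast
      then have "t \<in> bdry U" using s t by (auto simp: mem_bdry_iff)
      moreover have "t \<in> F" using V c by (auto simp: comps_iff)
      ultimately show False using c(2) unfolding comps_iff by blast
    qed
    then show ?thesis by blast
  qed
  have dis: "U \<inter> \<Union>\<U> = {}"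
  proof -
    have "U \<inter> V = {}" if "V \<in> \<U>" for V
      using comps_disjoint[of U F V] insert that by auto
    then show ?thesis by blast
  qed
  have "hc_sum p (\<Union>(insert U \<U>)) = hc_sum p (U \<union> \<Union>\<U>)" by simp
  also have "\<dots> = hc_sum p U * hc_sum p (\<Union>\<U>)"
    by (rule hc_sum_Un[OF _ _ dis adj]) (use insert in auto)
  finally show ?case using insert by simp
qed

text \<open>Both sides satisfy the recursion of \<open>Qpow_rec\<close> and equal one for
  \<open>n = 0\<close> and \<open>n = 1\<close>. The entry of the power \<open>n + 1\<close>
  describes \<open>n\<close> sites between two vacant end sites, each end contributing a factor
  \<open>sqrt (1 - p)\<close>; dividing by \<open>1 - p\<close> removes these.\<close>

lemma hc_sum_interval:
  assumes p: "0 < p" "p < 1"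
  shows "hc_sum p {a..<a + int n} = Qpow p (n + 1) False False / (1 - p)"
proof (induction n rule: induct_nat_012)
  case 0
  have "{Y \<in> Pow {}. hardcore Y} = {{}}" by (auto simp: hardcore_def)
  then show ?case using p by (simp add: hc_sum_def bern_wt_def UNIV_bool Qm_def)
next
  case 1
  have "{Y \<in> Pow {a}. hardcore Y} = {{}, {a}}" by (auto simp: hardcore_def)
  moreover have "{a..<a + int (Suc 0)} = {a}" by auto
  moreover have "Qpow p (Suc 0 + 1) False False = 1 - p"
    using Qpow_rec[OF p, of 0] by (simp add: UNIV_bool Qm_def algebra_simps)
  ultimately show ?case using p by (simp add: hc_sum_def bern_wt_def del: Qpow.simps)
next
  case (ge2 n)
  define S0 where "S0 = {a..<a + int n}"
  define S1 where "S1 = {a..<a + int (Suc n)}"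
  define S2 where "S2 = {a..<a + int (Suc (Suc n))}"
  define b where "b = a + int n"
  have S: "S1 = insert b S0" "S2 = insert (b + 1) S1" "b \<notin> S0" "b + 1 \<notin> S1" "b + 1 \<notin> S0"
    "finite S0" "finite S1" "\<And>i. i \<in> S0 \<Longrightarrow> i < b" "\<And>i. i \<in> S1 \<Longrightarrow> i \<le> b"
    by (auto simp: S0_def S1_def S2_def b_def)
  let ?h = "\<lambda>S. {Y \<in> Pow S. hardcore Y}"
  \<comment> \<open>Condition on the last site \<open>b + 1\<close>: if it is vacant the rest is
    arbitrary hard-core on \<open>S1\<close>, and if it is occupied then \<open>b\<close> must be
    vacant, leaving \<open>S0\<close>.\<close>
  have split: "?h S2 = ?h S1 \<union> insert (b + 1) ` ?h S0"
  proof (intro set_eqI iffI)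
    fix Y assume Y: "Y \<in> ?h S2"
    show "Y \<in> ?h S1 \<union> insert (b + 1) ` ?h S0"
    proof (cases "b + 1 \<in> Y")
      case True
      then have "b \<notin> Y" using Y by (auto simp: hardcore_def)
      then have "Y - {b + 1} \<in> ?h S0" using Y S by (auto simp: hardcore_def)
      moreover have "Y = insert (b + 1) (Y - {b + 1})" using True by blast
      ultimately show ?thesis by blast
    next
      case False
      then show ?thesis using Y S by auto
    qed
  next
    fix Y assume "Y \<in> ?h S1 \<union> insert (b + 1) ` ?h S0"
    then show "Y \<in> ?h S2"
    proof
      assume "Y \<in> ?h S1" then show ?thesis using S by auto
    next
      assume "Y \<in> insert (b + 1) ` ?h S0"
      then obtain Z where Z: "Y = insert (b + 1) Z" "Z \<subseteq> S0" "hardcore Z" by auto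
      have "i < b" if "i \<in> Z" for i using S(8) Z(2) that by blast
      then have "hardcore Y" using Z unfolding hardcore_def by force
      then show ?thesis using Z S by auto
    qed
  qed
  have inj: "inj_on (insert (b + 1)) (?h S0)"
    using S(5) by (intro inj_onI) (auto dest: insert_ident[THEN iffD1, rotated 2])
  have fin: "finite (?h S1)" "finite (?h S0)" using S by auto
  have dis: "?h S1 \<inter> insert (b + 1) ` ?h S0 = {}" using S(4) by auto
  have w1: "bern_wt p S2 Y = (1 - p) * bern_wt p S1 Y" if "Y \<in> ?h S1" for Y
  proof -
    have "S2 - Y = insert (b + 1) (S1 - Y)" using S(2,4) that by auto
    then show ?thesis using S by (simp add: bern_wt_def)
  qed
  have w0: "bern_wt p S2 (insert (b + 1) Y) = p * (1 - p) * bern_wt p S0 Y" if "Y \<in> ?h S0" for Y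
  proof -
    have "S2 - insert (b + 1) Y = insert b (S0 - Y)" using S that by auto
    moreover have "finite Y" "b + 1 \<notin> Y" using that S(5,6) by (auto intro: finite_subset)
    ultimately show ?thesis using S by (simp add: bern_wt_def)
  qed
  have "hc_sum p S2 = (1 - p) * hc_sum p S1 + p * (1 - p) * hc_sum p S0"
    unfolding hc_sum_def split sum.union_disjoint[OF fin(1) finite_imageI[OF fin(2)] dis]
      sum.reindex[OF inj] sum_distrib_left o_def
    by (intro arg_cong2[of _ _ _ _ "(+)"] sum.cong refl w1 w0)
  then show ?case
    using ge2 Qpow_rec[OF p, of "Suc n"] unfolding S0_def S1_def S2_def
    by (simp add: add_divide_distrib del: Qpow.simps of_nat_Suc)
qed

lemma hc_sum_iconvex:
  assumes "0 < p" "p < 1" "iconvex U" "finite U" "U \<noteq> {}"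
  shows "hc_sum p U = Zc p \<Lambda> U"
proof -
  have "U = {Min U..<Min U + int (card U)}"
    using assms(3,5)
  proof (cases rule: iconvex_cases)
    case (fin a b)
    then have "Min U = a" by (auto intro!: Min_eqI)
    then show ?thesis using fin by auto
  qed (use assms(4) in \<open>auto simp: infinite_Iic infinite_Ici infinite_UNIV_int\<close>)
  then have "hc_sum p U = Qpow p (card U + 1) False False / (1 - p)"
    using hc_sum_interval[OF assms(1,2), of "Min U" "card U"] by metis
  then show ?thesis using assms(4) by (simp add: Zc_def del: Qpow.simps)
qed

section \<open>Fibres of the thinning inside a decoupled interval\<close>

definition doubled :: "int \<Rightarrow> cfg set" where
  "doubled n = {\<omega>. \<omega> (- n - 1) \<and> \<omega> (- n) \<and> \<omega> n \<and> \<omega> (n + 1)}"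

text \<open>Within each of the two pairs the sites protect each other from removal, so the event can
  be read off before or after thinning.\<close>

lemma thin_doubled: "thin \<omega> \<in> doubled n \<longleftrightarrow> \<omega> \<in> doubled n"
  by (auto simp: doubled_def thin_def)

text \<open>Beyond the ends, no neighbour of the site lies in the redrawn interval. The ends
  themselves do have a redrawn neighbour, but their occupied outer neighbour keeps them alive
  whatever is drawn.\<close>

lemma thin_mrg_off:
  assumes \<omega>: "\<omega> \<in> doubled n" and i: "i \<notin> {-n<..<n}"
  shows "thin (mrg {-n<..<n} X \<omega>) i = thin \<omega> i"
proof -
  consider "i < - n" | "i = - n" | "i = n" | "n < i" using i by force
  then show ?thesis
  proof cases
    case 1 then show ?thesis by (simp add: thin_def mrg_def)
  next
    case 2
    have "- n - 1 \<notin> {-n<..<n}" "- n \<notin> {-n<..<n}" by auto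
    then show ?thesis using 2 \<omega> by (simp add: thin_def mrg_def doubled_def)
  next
    case 3
    have "n + 1 \<notin> {-n<..<n}" "n \<notin> {-n<..<n}" by auto
    then show ?thesis using 3 \<omega> by (simp add: thin_def mrg_def doubled_def)
  next
    case 4 then show ?thesis by (simp add: thin_def mrg_def)
  qed
qed

text \<open>Sites occupied in \<eta> must be occupied originally. A vacant site next to one of them
  must be vacant originally, since it would otherwise survive. On the free sites the original
  occupied set may be anything whose points are all removed, that is, a hard-core set.\<close>

lemma thin_mrg_eq_iff:
  assumes \<omega>: "\<omega> \<in> doubled n" and \<eta>: "\<eta> \<in> Conf {-n<..<n} (thin \<omega>)" and X: "X \<subseteq> {-n<..<n}"
  shows "thin (mrg {-n<..<n} X \<omega>) = \<eta> \<longleftrightarrow>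
    (\<exists>Y. Y \<subseteq> free \<eta> \<inter> {-n<..<n} \<and> hardcore Y \<and> X = Theta \<eta> \<inter> {-n<..<n} \<union> Y)"
proof -
  let ?D = "{-n<..<n}"
  define \<omega>' where "\<omega>' = mrg ?D X \<omega>"
  have off: "thin \<omega>' i = \<eta> i" if "i \<notin> ?D" for i
    using thin_mrg_off[OF \<omega> that] \<eta> that by (simp add: Conf_def \<omega>'_def)
  have in': "\<omega>' i \<longleftrightarrow> i \<in> X" if "i \<in> ?D" for i using that by (simp add: \<omega>'_def mrg_def)
  have ends: "\<omega>' n" "\<omega>' (- n)" "\<eta> n" "\<eta> (- n)"
  proof -
    have D: "n \<notin> ?D" "- n \<notin> ?D" by auto
    then show o: "\<omega>' n" "\<omega>' (- n)" using \<omega> by (simp_all add: \<omega>'_def mrg_def doubled_def)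
    have "thin \<omega> \<in> doubled n" using \<omega> by (simp add: thin_doubled)
    then show "\<eta> n" "\<eta> (- n)" using \<eta> D by (simp_all add: Conf_def doubled_def)
  qed
  have \<eta>O: "\<eta> (i - 1) \<or> \<eta> (i + 1)" if "\<eta> i" for i
    using \<eta> that unfolding Conf_def Omega'_eq by blast
  have nb: "j \<in> ?D \<or> j = n \<or> j = - n" if "i \<in> ?D" "j = i - 1 \<or> j = i + 1" for i j
    using that by auto
  show ?thesis unfolding \<omega>'_def[symmetric]
  proof
    assume t: "thin \<omega>' = \<eta>"
    define Y where "Y = X \<inter> free \<eta>"
    have "hardcore Y" unfolding hardcore_def
    proof (intro ballI notI)
      fix i assume i: "i \<in> Y" "i + 1 \<in> Y"
      then have "\<omega>' i" "\<omega>' (i + 1)" using in' X by (auto simp: Y_def)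
      then have "\<eta> i" using t by (auto simp: thin_def)
      then show False using i by (simp add: Y_def free_def)
    qed
    moreover have "Y \<subseteq> free \<eta> \<inter> ?D" using X by (auto simp: Y_def)
    moreover have "X = Theta \<eta> \<inter> ?D \<union> Y"
    proof (intro set_eqI iffI)
      fix x assume x: "x \<in> X"
      then have o: "\<omega>' x" using in' X by blast
      \<comment> \<open>An occupied site that is removed has no occupied neighbour, so the thinned
        configuration is vacant at the site and on both sides of it.\<close>
      have "x \<in> free \<eta>" if "\<not> \<eta> x"
      proof -
        have "\<not> \<omega>' (x - 1)" "\<not> \<omega>' (x + 1)" using o t that by (auto simp: thin_def)
        then have "\<not> \<eta> (x - 1)" "\<not> \<eta> (x + 1)" using t by (auto simp: thin_def)
        then show ?thesis using that by (simp add: free_def)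
      qed
      then show "x \<in> Theta \<eta> \<inter> ?D \<union> Y" using x X by (auto simp: Theta_def Y_def)
    next
      fix x assume "x \<in> Theta \<eta> \<inter> ?D \<union> Y"
      then show "x \<in> X"
      proof
        assume x: "x \<in> Theta \<eta> \<inter> ?D"
        then have "thin \<omega>' x" using t by (simp add: Theta_def)
        then have "\<omega>' x" by (simp add: thin_def)
        then show ?thesis using in' x by blast
      qed (simp add: Y_def)
    qed
    ultimately show "\<exists>Y. Y \<subseteq> free \<eta> \<inter> ?D \<and> hardcore Y \<and> X = Theta \<eta> \<inter> ?D \<union> Y" by blast
  next
    assume "\<exists>Y. Y \<subseteq> free \<eta> \<inter> ?D \<and> hardcore Y \<and> X = Theta \<eta> \<inter> ?D \<union> Y"
    then obtain Y where Y: "Y \<subseteq> free \<eta> \<inter> ?D" "hardcore Y" "X = Theta \<eta> \<inter> ?D \<union> Y" by blast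
    \<comment> \<open>The formula is extended to the two ends, where both configurations are
      occupied, because sites of the interval may have an end as neighbour.\<close>
    have val: "\<omega>' j \<longleftrightarrow> \<eta> j \<or> j \<in> Y" if "j \<in> ?D \<or> j = n \<or> j = - n" for j
    proof (cases "j \<in> ?D")
      case True then show ?thesis using in' Y(3) by (auto simp: Theta_def)
    next
      case False then show ?thesis using that ends by auto
    qed
    show "thin \<omega>' = \<eta>"
    proof
      fix i
      show "thin \<omega>' i = \<eta> i"
      proof (cases "i \<in> ?D")
        case False then show ?thesis by (rule off)
      next
        case True
        note v = val[of i] val[OF nb[OF True, of "i - 1"]] val[OF nb[OF True, of "i + 1"]]
        show ?thesis
        proof (cases "\<eta> i")
          case e: True
          then show ?thesis using v True \<eta>O[OF e] by (auto simp: thin_def)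
        next
          case e: False
          show ?thesis
          proof (cases "i \<in> Y")
            case y: True
            then have "\<not> \<eta> (i - 1)" "\<not> \<eta> (i + 1)" using Y(1) by (auto simp: free_def)
            moreover have "i + 1 \<notin> Y" using Y(2) y by (auto simp: hardcore_def)
            moreover have "i - 1 \<notin> Y"
            proof
              assume "i - 1 \<in> Y"
              then have "i - 1 + 1 \<notin> Y" using Y(2) unfolding hardcore_def by blast
              then show False using y by simp
            qed
            ultimately show ?thesis using v e by (auto simp: thin_def)
          next
            case False then show ?thesis using v True e by (auto simp: thin_def)
          qed
        qed
      qed
    qed
  qed
qed

text \<open>The interval splits into \<open>T\<close>, forced occupied, \<open>B\<close>, forced
  vacant, and \<open>S\<close>, carrying a hard-core set, whose sum factorises over the components.
  The weight also counts the occupied ends \<open>n\<close> and \<open>- n\<close> of the closure,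
  which accounts for the square of \<open>p\<close>.\<close>

lemma fiber_weight:
  assumes p: "0 < p" "p < 1" and n: "0 < n"
    and \<omega>: "\<omega> \<in> doubled n" and \<eta>: "\<eta> \<in> Conf {-n<..<n} (thin \<omega>)"
  shows "(\<Sum>X | X \<in> Pow {-n<..<n} \<and> thin (mrg {-n<..<n} X \<omega>) = \<eta>. bern_wt p {-n<..<n} X)
    = Wt p {-n<..<n} \<eta> / p\<^sup>2"
proof -
  let ?D = "{-n<..<n}"
  have \<eta>d: "\<eta> \<in> doubled n"
  proof -
    have "- n - 1 \<notin> ?D" "- n \<notin> ?D" "n \<notin> ?D" "n + 1 \<notin> ?D" by auto
    moreover have "thin \<omega> \<in> doubled n" using \<omega> by (simp add: thin_doubled)
    ultimately show ?thesis using \<eta> by (simp add: Conf_def doubled_def)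
  qed
  define S where "S = free \<eta> \<inter> ?D"
  define T where "T = Theta \<eta> \<inter> ?D"
  define B where "B = bdry (Theta \<eta>) \<inter> ?D"
  have finS: "finite S" "finite T" "finite B" by (auto simp: S_def T_def B_def)
  have dis: "S \<inter> T = {}" "S \<inter> B = {}" "T \<inter> B = {}"
    by (auto simp: S_def T_def B_def free_def Theta_def mem_bdry_iff)
  have D: "?D = S \<union> T \<union> B" by (auto simp: S_def T_def B_def free_def Theta_def mem_bdry_iff)
  have "(\<Sum>X | X \<in> Pow ?D \<and> thin (mrg ?D X \<omega>) = \<eta>. bern_wt p ?D X)
    = (\<Sum>Y\<in>{Y \<in> Pow S. hardcore Y}. p ^ card T * (1 - p) ^ card B * bern_wt p S Y)"
  proof (rule sum.reindex_bij_witness[where i="\<lambda>Y. T \<union> Y" and j="\<lambda>X. X \<inter> S"])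
    fix X assume "X \<in> {X. X \<in> Pow ?D \<and> thin (mrg ?D X \<omega>) = \<eta>}"
    then obtain Y where Y: "Y \<subseteq> S" "hardcore Y" "X = T \<union> Y"
      using thin_mrg_eq_iff[OF \<omega> \<eta>, of X] unfolding S_def T_def by blast
    have XS: "X \<inter> S = Y" using Y dis by blast
    then show "T \<union> (X \<inter> S) = X" "X \<inter> S \<in> {Y \<in> Pow S. hardcore Y}" using Y by auto
    have "card X = card T + card Y" unfolding Y(3)
      by (rule card_Un_disjoint) (use Y dis finS in \<open>auto intro: finite_subset\<close>)
    moreover have "?D - X = B \<union> (S - Y)" unfolding D Y(3) using dis Y(1) by blast
    moreover have "card (B \<union> (S - Y)) = card B + card (S - Y)"
      by (rule card_Un_disjoint) (use finS dis in auto)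
    ultimately show "p ^ card T * (1 - p) ^ card B * bern_wt p S (X \<inter> S) = bern_wt p ?D X"
      unfolding XS by (simp add: bern_wt_def power_add)
  next
    fix Y assume Y: "Y \<in> {Y \<in> Pow S. hardcore Y}"
    then show "(T \<union> Y) \<inter> S = Y" using dis by blast
    have "T \<union> Y \<subseteq> ?D" using Y by (auto simp: S_def T_def)
    moreover have "thin (mrg ?D (T \<union> Y) \<omega>) = \<eta>"
      unfolding thin_mrg_eq_iff[OF \<omega> \<eta> calculation] using Y unfolding S_def T_def by blast
    ultimately show "T \<union> Y \<in> {X. X \<in> Pow ?D \<and> thin (mrg ?D X \<omega>) = \<eta>}" by blast
  qed
  also have "\<dots> = p ^ card T * (1 - p) ^ card B * hc_sum p S"
    by (simp add: hc_sum_def sum_distrib_left)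
  also have "hc_sum p S = (\<Prod>U\<in>UL ?D \<eta>. Zc p ?D U)"
  proof -
    have cc: "clos (clos ?D) = {- n - 1..n + 1}"
    proof -
      have "clos ?D = {-n..n}" using n by (auto simp: mem_clos_iff)
      then show ?thesis using n by (auto simp: mem_clos_iff)
    qed
    have nf: "- n - 1 \<notin> free \<eta>" "- n \<notin> free \<eta>" "n \<notin> free \<eta>" "n + 1 \<notin> free \<eta>"
      using \<eta>d by (auto simp: free_def doubled_def)
    \<comment> \<open>The relevant components could touch sites up to distance \<open>n + 1\<close>
      from the origin, but the ends and their outer neighbours are not free. So a component meets
      the open interval, and cannot leave it without crossing an end.\<close>
    have sub: "U \<subseteq> S" if U: "U \<in> UL ?D \<eta>" for U
    proof -
      have c: "iconvex U" "U \<subseteq> free \<eta>" using U by (auto simp: UL_eq comps_iff)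
      obtain u where u: "u \<in> U" "- n - 1 \<le> u" "u \<le> n + 1" using U unfolding UL_eq cc by auto
      have "u \<noteq> - n - 1" "u \<noteq> - n" "u \<noteq> n" "u \<noteq> n + 1" using u(1) c(2) nf by auto
      then have u': "- n < u" "u < n" using u by auto
      show ?thesis
      proof
        fix x assume x: "x \<in> U"
        have "- n < x"
        proof (rule ccontr)
          assume "\<not> - n < x"
          then have "- n \<in> U" using iconvexD[OF c(1) x u(1), of "- n"] u' by simp
          then show False using c nf by blast
        qed
        moreover have "x < n"
        proof (rule ccontr)
          assume "\<not> x < n"
          then have "n \<in> U" using iconvexD[OF c(1) u(1) x, of n] u' by simp
          then show False using c nf by blast
        qed
        ultimately show "x \<in> S" using c x by (auto simp: S_def)
      qed
    qed
    have "S = \<Union>(UL ?D \<eta>)"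
    proof
      show "S \<subseteq> \<Union>(UL ?D \<eta>)"
      proof
        fix x assume x: "x \<in> S"
        then obtain U where U: "U \<in> comps (free \<eta>)" "x \<in> U" using comps_cover unfolding S_def by blast
        then have "U \<in> UL ?D \<eta>" using x unfolding UL_eq cc S_def by auto
        then show "x \<in> \<Union>(UL ?D \<eta>)" using U by blast
      qed
    qed (use sub in blast)
    then have "hc_sum p S = (\<Prod>U\<in>UL ?D \<eta>. hc_sum p U)"
      using hc_sum_Union_comps[of "UL ?D \<eta>" "free \<eta>" p] finite_UL[of ?D \<eta>] sub finS(1)
      by (auto simp: UL_eq intro: finite_subset)
    also have "\<dots> = (\<Prod>U\<in>UL ?D \<eta>. Zc p ?D U)"
    proof (rule prod.cong[OF refl])
      fix U assume U: "U \<in> UL ?D \<eta>"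
      then have "iconvex U" "U \<noteq> {}" by (auto simp: UL_eq comps_iff)
      then show "hc_sum p U = Zc p ?D U"
        using hc_sum_iconvex[OF p _ finite_subset[OF sub[OF U] finS(1)]] by blast
    qed
    finally show ?thesis .
  qed
  also have "p ^ card T * (1 - p) ^ card B * (\<Prod>U\<in>UL ?D \<eta>. Zc p ?D U) = Wt p ?D \<eta> / p\<^sup>2"
  proof -
    have cl: "clos ?D = {-n..n}" using n by (auto simp: mem_clos_iff)
    have "Theta \<eta> \<inter> clos ?D = insert n (insert (- n) T)"
      using \<eta>d n unfolding cl by (auto simp: T_def Theta_def doubled_def)
    then have "card (Theta \<eta> \<inter> clos ?D) = card T + 2"
      using n finS by (simp add: T_def)
    moreover have "bdry (Theta \<eta>) \<inter> clos ?D = B"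
    proof -
      have "n \<notin> bdry (Theta \<eta>)" "- n \<notin> bdry (Theta \<eta>)"
        using \<eta>d by (auto simp: mem_bdry_iff Theta_def doubled_def)
      then show ?thesis unfolding cl B_def by (auto simp: order_le_less)
    qed
    ultimately show ?thesis using p by (simp add: Wt_def power_add power2_eq_square)
  qed
  finally show ?thesis .
qed

section \<open>The DLR equations\<close>

lemma sets_mu: "sets (mu p) = sets OmegaM"
  unfolding mu_def OmegaM_def by (rule sets_PiM_cong) auto

lemma space_mu: "space (mu p) = UNIV"
  using sets_eq_imp_space_eq[OF sets_mu] by simp

lemma prob_space_mu: "prob_space (mu p)"
  unfolding mu_def by (intro prob_space_PiM prob_space_measure_pmf)

lemma measurable_mu: "f \<in> measurable OmegaM N \<Longrightarrow> f \<in> measurable (mu p) N"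
  using measurable_cong_sets[OF sets_mu[of p] refl, of N] by simp

text \<open>A product measure is unchanged when one coordinate is overwritten by an independent
  copy; integrating out that copy leaves a sum over its two values.\<close>

lemma resample_site:
  assumes p: "0 < p" "p < 1" and f: "f \<in> borel_measurable OmegaM"
  shows "(\<integral>\<^sup>+\<omega>. f \<omega> \<partial>mu p)
    = (\<integral>\<^sup>+\<omega>. f (fun_upd \<omega> i True) * ennreal p + f (fun_upd \<omega> i False) * ennreal (1 - p) \<partial>mu p)"
proof -
  let ?B = "measure_pmf (bernoulli_pmf p)"
  interpret M: prob_space "mu p" by (rule prob_space_mu)
  interpret P: pair_sigma_finite ?B "mu p"
    by (intro pair_sigma_finite.intro prob_space_imp_sigma_finite prob_space_mu prob_space_measure_pmf)
  have eq: "distr (?B \<Otimes>\<^sub>M mu p) (mu p) (\<lambda>(x, X). fun_upd X i x) = mu p"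
    using distr_pair_PiM_eq_PiM[of UNIV "\<lambda>_. ?B" i] unfolding mu_def
    by (simp add: prob_space_measure_pmf)
  have m: "(\<lambda>(x, X). fun_upd X i x) \<in> measurable (?B \<Otimes>\<^sub>M mu p) (mu p)"
  proof -
    have "(\<lambda>(x, X). fun_upd X i x) \<in> measurable (?B \<Otimes>\<^sub>M mu p) OmegaM"
    proof (rule measurable_OmegaM_I)
      fix j
      have 1: "(\<lambda>\<omega>. \<omega> j) \<in> measurable (mu p) (count_space UNIV)"
        by (rule measurable_mu) (rule measurable_spin)
      have 2: "fst \<in> measurable (?B \<Otimes>\<^sub>M mu p) (count_space UNIV)"
        using measurable_fst[of ?B "mu p"] by (simp cong: measurable_cong_sets)
      show "(\<lambda>z. (case z of (x, X) \<Rightarrow> fun_upd X i x) j) \<in> measurable (?B \<Otimes>\<^sub>M mu p) (count_space UNIV)"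
        using 2 measurable_compose[OF measurable_snd 1]
        by (cases "j = i") (simp_all add: case_prod_beta')
    qed
    then show ?thesis using measurable_cong_sets[OF refl sets_mu[of p]] by blast
  qed
  have fm: "f \<in> borel_measurable (mu p)" using f by (rule measurable_mu)
  have "(\<integral>\<^sup>+\<omega>. f \<omega> \<partial>mu p) = (\<integral>\<^sup>+\<omega>. f \<omega> \<partial>distr (?B \<Otimes>\<^sub>M mu p) (mu p) (\<lambda>(x, X). fun_upd X i x))"
    by (simp only: eq)
  also have "\<dots> = (\<integral>\<^sup>+z. f (case z of (x, X) \<Rightarrow> fun_upd X i x) \<partial>(?B \<Otimes>\<^sub>M mu p))"
    by (rule nn_integral_distr[OF m]) (use fm in simp)
  also have "\<dots> = (\<integral>\<^sup>+\<omega>. (\<integral>\<^sup>+x. f (case (x, \<omega>) of (x, X) \<Rightarrow> fun_upd X i x) \<partial>?B) \<partial>mu p)"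
    by (rule P.nn_integral_snd[symmetric]) (rule measurable_compose[OF m fm])
  also have "\<dots> = (\<integral>\<^sup>+\<omega>. f (fun_upd \<omega> i True) * ennreal p + f (fun_upd \<omega> i False) * ennreal (1 - p) \<partial>mu p)"
    using p by simp
  finally show ?thesis .
qed

lemma measurable_mrg_OmegaM: "mrg \<Lambda> X \<in> measurable OmegaM OmegaM"
  by (rule measurable_OmegaM_I) (auto simp: mrg_def)

text \<open>The Bernoulli field is invariant under redrawing the spins in \<open>\<Delta>\<close>; all uses of independence go through this.\<close>

lemma resample:
  assumes p: "0 < p" "p < 1" and "finite \<Delta>" and f: "f \<in> borel_measurable OmegaM"
  shows "(\<integral>\<^sup>+\<omega>. f \<omega> \<partial>mu p) = (\<integral>\<^sup>+\<omega>. (\<Sum>X\<in>Pow \<Delta>. ennreal (bern_wt p \<Delta> X) * f (mrg \<Delta> X \<omega>)) \<partial>mu p)"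
  using \<open>finite \<Delta>\<close>
proof (induction \<Delta> rule: finite_induct)
  case empty
  have "mrg {} {} = (\<lambda>\<omega>. \<omega>)" by (auto simp: mrg_def)
  then show ?case by (simp add: bern_wt_def)
next
  case (insert i \<Delta>)
  let ?g = "\<lambda>\<omega>. \<Sum>X\<in>Pow \<Delta>. ennreal (bern_wt p \<Delta> X) * f (mrg \<Delta> X \<omega>)"
  have g: "?g \<in> borel_measurable OmegaM"
    using measurable_compose[OF measurable_mrg_OmegaM f]
    by (intro borel_measurable_sum borel_measurable_times_ennreal) auto
  \<comment> \<open>The value drawn at \<open>i\<close> becomes membership of \<open>i\<close> in
    the enlarged set; no overwriting occurs since \<open>i\<close> is not in \<Delta>.\<close>
  have m: "mrg \<Delta> X (fun_upd \<omega> i True) = mrg (insert i \<Delta>) (insert i X) \<omega>"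
    "mrg \<Delta> X (fun_upd \<omega> i False) = mrg (insert i \<Delta>) X \<omega>" if "X \<in> Pow \<Delta>" for X \<omega>
    using that insert(2) by (auto simp: mrg_def fun_eq_iff)
  have w: "ennreal (bern_wt p \<Delta> X) * ennreal p = ennreal (bern_wt p (insert i \<Delta>) (insert i X))"
    "ennreal (bern_wt p \<Delta> X) * ennreal (1 - p) = ennreal (bern_wt p (insert i \<Delta>) X)" if "X \<in> Pow \<Delta>" for X
  proof -
    have X: "finite X" "i \<notin> X" using that insert(1,2) by (auto intro: finite_subset)
    have "insert i \<Delta> - insert i X = \<Delta> - X" "insert i \<Delta> - X = insert i (\<Delta> - X)" using X insert(2) by auto
    moreover have "i \<notin> \<Delta> - X" "finite (\<Delta> - X)" using insert by auto
    ultimately have "bern_wt p (insert i \<Delta>) (insert i X) = bern_wt p \<Delta> X * p"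
      "bern_wt p (insert i \<Delta>) X = bern_wt p \<Delta> X * (1 - p)"
      using X by (simp_all add: bern_wt_def)
    moreover have "0 \<le> bern_wt p \<Delta> X" using p by (simp add: bern_wt_def)
    ultimately show "ennreal (bern_wt p \<Delta> X) * ennreal p = ennreal (bern_wt p (insert i \<Delta>) (insert i X))"
      "ennreal (bern_wt p \<Delta> X) * ennreal (1 - p) = ennreal (bern_wt p (insert i \<Delta>) X)"
      using p by (simp_all add: ennreal_mult)
  qed
  have "(\<integral>\<^sup>+\<omega>. f \<omega> \<partial>mu p) = (\<integral>\<^sup>+\<omega>. ?g \<omega> \<partial>mu p)" by (rule insert.IH)
  also have "\<dots> = (\<integral>\<^sup>+\<omega>. ?g (fun_upd \<omega> i True) * ennreal p + ?g (fun_upd \<omega> i False) * ennreal (1 - p) \<partial>mu p)"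
    by (rule resample_site[OF p g])
  also have "\<dots> = (\<integral>\<^sup>+\<omega>. (\<Sum>X\<in>Pow (insert i \<Delta>). ennreal (bern_wt p (insert i \<Delta>) X) * f (mrg (insert i \<Delta>) X \<omega>)) \<partial>mu p)"
  proof (rule nn_integral_cong)
    fix \<omega>
    let ?h = "\<lambda>X. ennreal (bern_wt p (insert i \<Delta>) X) * f (mrg (insert i \<Delta>) X \<omega>)"
    have inj: "inj_on (insert i) (Pow \<Delta>)"
      using insert(2) by (intro inj_onI) (auto dest: insert_ident[THEN iffD1, rotated 2])
    have "(\<Sum>X\<in>Pow (insert i \<Delta>). ?h X) = (\<Sum>X\<in>Pow \<Delta>. ?h X) + (\<Sum>X\<in>insert i ` Pow \<Delta>. ?h X)"
      unfolding Pow_insert using insert(1,2) by (intro sum.union_disjoint) auto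
    also have "(\<Sum>X\<in>insert i ` Pow \<Delta>. ?h X) = (\<Sum>X\<in>Pow \<Delta>. ?h (insert i X))"
      by (simp add: sum.reindex[OF inj])
    also have "\<dots> = ?g (fun_upd \<omega> i True) * ennreal p"
      unfolding sum_distrib_right
    proof (rule sum.cong[OF refl])
      fix X assume X: "X \<in> Pow \<Delta>"
      show "?h (insert i X) = ennreal (bern_wt p \<Delta> X) * f (mrg \<Delta> X (fun_upd \<omega> i True)) * ennreal p"
        unfolding m(1)[OF X] w(1)[OF X, symmetric] by (simp only: ac_simps)
    qed
    also have "(\<Sum>X\<in>Pow \<Delta>. ?h X) = ?g (fun_upd \<omega> i False) * ennreal (1 - p)"
      unfolding sum_distrib_right
    proof (rule sum.cong[OF refl])
      fix X assume X: "X \<in> Pow \<Delta>"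
      show "?h X = ennreal (bern_wt p \<Delta> X) * f (mrg \<Delta> X (fun_upd \<omega> i False)) * ennreal (1 - p)"
        unfolding m(2)[OF X] w(2)[OF X, symmetric] by (simp only: ac_simps)
    qed
    finally show "?g (fun_upd \<omega> i True) * ennreal p + ?g (fun_upd \<omega> i False) * ennreal (1 - p) = (\<Sum>X\<in>Pow (insert i \<Delta>). ?h X)"
      by (simp only: add.commute)
  qed
  finally show ?case .
qed

lemma bern_wt_nonneg: "0 < p \<Longrightarrow> p < 1 \<Longrightarrow> 0 \<le> bern_wt p \<Delta> X"
  by (simp add: bern_wt_def)

lemma sum_bern_wt:
  assumes p: "0 < p" "p < 1" and fin: "finite \<Delta>"
  shows "(\<Sum>X\<in>Pow \<Delta>. bern_wt p \<Delta> X) = 1"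
proof -
  interpret M: prob_space "mu p" by (rule prob_space_mu)
  have "ennreal (\<Sum>X\<in>Pow \<Delta>. bern_wt p \<Delta> X) = (\<Sum>X\<in>Pow \<Delta>. ennreal (bern_wt p \<Delta> X))"
    using bern_wt_nonneg[OF p] by (intro sum_ennreal[symmetric]) auto
  also have "\<dots> = 1"
    using resample[OF p fin, of "\<lambda>_. 1"] M.emeasure_space_1 by simp
  finally show ?thesis by simp
qed

text \<open>On the decoupling event, redrawing the interior and then thinning has exactly the law of
  the kernel: grouping the drawn sets by their thinned image turns Bernoulli weights into kernel
  weights via \<open>fiber_weight\<close>.\<close>

lemma nn_integral_gamma'_doubled:
  assumes p: "0 < p" "p < 1" and n: "0 < n" and \<omega>: "\<omega> \<in> doubled n"
    and f: "f \<in> borel_measurable F'"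
  shows "(\<Sum>X\<in>Pow {-n<..<n}. ennreal (bern_wt p {-n<..<n} X) * f (thin (mrg {-n<..<n} X \<omega>)))
    = (\<integral>\<^sup>+\<eta>. f \<eta> \<partial>gamma' p {-n<..<n} (thin \<omega>))"
proof -
  let ?D = "{-n<..<n}" and ?C = "Conf {-n<..<n} (thin \<omega>)" and ?t = "\<lambda>X. thin (mrg {-n<..<n} X \<omega>)"
  have C: "?t ` Pow ?D \<subseteq> ?C"
    using thin_mrg_off[OF \<omega>] thin_in_Omega' by (auto simp: Conf_def)
  have finC: "finite ?C" by (rule finite_Conf) simp
  have group: "(\<Sum>\<eta>\<in>?C. \<Sum>X | X \<in> Pow ?D \<and> ?t X = \<eta>. h X) = (\<Sum>X\<in>Pow ?D. h X)" for h :: "int set \<Rightarrow> 'a::comm_monoid_add"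
    by (rule sum.group[OF _ finC C]) simp
  \<comment> \<open>The fibres partition all drawn sets, whose total weight is one; this identifies
    the normalisation without computing it.\<close>
  have Z: "Zpart p ?D (thin \<omega>) = p\<^sup>2"
  proof -
    have "Zpart p ?D (thin \<omega>) / p\<^sup>2 = (\<Sum>\<eta>\<in>?C. \<Sum>X | X \<in> Pow ?D \<and> ?t X = \<eta>. bern_wt p ?D X)"
      unfolding Zpart_def sum_divide_distrib
      by (rule sum.cong[OF refl]) (simp only: fiber_weight[OF p n \<omega>])
    also have "\<dots> = (\<Sum>X\<in>Pow ?D. bern_wt p ?D X)" by (rule group)
    also have "\<dots> = 1" by (rule sum_bern_wt[OF p]) simp
    finally show ?thesis using p by (simp add: field_simps)
  qed
  have "(\<integral>\<^sup>+\<eta>. f \<eta> \<partial>gamma' p ?D (thin \<omega>)) = (\<Sum>\<eta>\<in>?C. ennreal (Wt p ?D \<eta> / p\<^sup>2) * f \<eta>)"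
    using nn_integral_gamma'[OF p _ thin_in_Omega' f, of ?D \<omega>] unfolding Z by simp
  also have "\<dots> = (\<Sum>\<eta>\<in>?C. \<Sum>X | X \<in> Pow ?D \<and> ?t X = \<eta>. ennreal (bern_wt p ?D X) * f (?t X))"
  proof (rule sum.cong[OF refl])
    fix \<eta> assume e: "\<eta> \<in> ?C"
    have "ennreal (Wt p ?D \<eta> / p\<^sup>2) = (\<Sum>X | X \<in> Pow ?D \<and> ?t X = \<eta>. ennreal (bern_wt p ?D X))"
      unfolding fiber_weight[OF p n \<omega> e, symmetric]
      using bern_wt_nonneg[OF p] by (intro sum_ennreal[symmetric]) auto
    then show "ennreal (Wt p ?D \<eta> / p\<^sup>2) * f \<eta>
      = (\<Sum>X | X \<in> Pow ?D \<and> ?t X = \<eta>. ennreal (bern_wt p ?D X) * f (?t X))"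
      by (simp add: sum_distrib_right)
  qed
  also have "\<dots> = (\<Sum>X\<in>Pow ?D. ennreal (bern_wt p ?D X) * f (?t X))" by (rule group)
  finally show ?thesis ..
qed

section \<open>The DLR equations on a decoupling event\<close>

lemma doubled_sets: "doubled n \<in> sets OmegaM"
proof -
  have "{\<omega> \<in> space OmegaM. \<omega> (- n - 1) \<and> \<omega> (- n) \<and> \<omega> n \<and> \<omega> (n + 1)} \<in> sets OmegaM" by measurable
  then show ?thesis by (simp add: doubled_def)
qed

lemma sets_mu' [simp]: "sets (mu' p) = sets F'"
  by (simp add: mu'_def)

lemma nn_integral_mu':
  assumes f: "f \<in> borel_measurable F'"
  shows "(\<integral>\<^sup>+\<eta>. f \<eta> \<partial>mu' p) = (\<integral>\<^sup>+\<omega>. f (thin \<omega>) \<partial>mu p)"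
  unfolding mu'_def by (rule nn_integral_distr[OF measurable_mu[OF measurable_thin]]) (use f in simp)

text \<open>Redrawing the interior does not touch the four sites defining the event, so its
  indicator factors out of the average; what remains is the kernel integral.\<close>

lemma nn_integral_mu'_doubled:
  assumes p: "0 < p" "p < 1" and n: "0 < n" and f: "f \<in> borel_measurable F'"
  shows "(\<integral>\<^sup>+\<eta>. indicator (doubled n) \<eta> * f \<eta> \<partial>mu' p)
    = (\<integral>\<^sup>+\<omega>. indicator (doubled n) \<omega> * (\<integral>\<^sup>+\<eta>. f \<eta> \<partial>gamma' p {-n<..<n} (thin \<omega>)) \<partial>mu p)"
proof -
  let ?D = "{-n<..<n}"
  have ind: "(\<lambda>\<eta>. indicator (doubled n) \<eta> :: ennreal) \<in> borel_measurable F'"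
    unfolding F'_def by (rule measurable_restrict_space1) (use doubled_sets in simp)
  let ?h = "\<lambda>\<omega>. indicator (doubled n) \<omega> * f (thin \<omega>)"
  have h: "?h \<in> borel_measurable OmegaM"
    using doubled_sets measurable_compose[OF measurable_thin f]
    by (intro borel_measurable_times_ennreal) simp_all
  have "(\<integral>\<^sup>+\<eta>. indicator (doubled n) \<eta> * f \<eta> \<partial>mu' p) = (\<integral>\<^sup>+\<omega>. ?h \<omega> \<partial>mu p)"
    using nn_integral_mu'[OF borel_measurable_times_ennreal[OF ind f], of p]
    by (simp add: indicator_def thin_doubled)
  also have "\<dots> = (\<integral>\<^sup>+\<omega>. (\<Sum>X\<in>Pow ?D. ennreal (bern_wt p ?D X) * ?h (mrg ?D X \<omega>)) \<partial>mu p)"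
    by (rule resample[OF p _ h]) simp
  also have "\<dots> = (\<integral>\<^sup>+\<omega>. indicator (doubled n) \<omega> * (\<integral>\<^sup>+\<eta>. f \<eta> \<partial>gamma' p ?D (thin \<omega>)) \<partial>mu p)"
  proof (rule nn_integral_cong)
    fix \<omega>
    have D: "- n - 1 \<notin> ?D" "- n \<notin> ?D" "n \<notin> ?D" "n + 1 \<notin> ?D" by auto
    have m: "mrg ?D X \<omega> \<in> doubled n \<longleftrightarrow> \<omega> \<in> doubled n" for X
      using D by (simp add: doubled_def mrg_def)
    show "(\<Sum>X\<in>Pow ?D. ennreal (bern_wt p ?D X) * ?h (mrg ?D X \<omega>))
      = indicator (doubled n) \<omega> * (\<integral>\<^sup>+\<eta>. f \<eta> \<partial>gamma' p ?D (thin \<omega>))"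
    proof (cases "\<omega> \<in> doubled n")
      case True
      then show ?thesis using m nn_integral_gamma'_doubled[OF p n True f] by simp
    next
      case False
      then show ?thesis using m by simp
    qed
  qed
  finally show ?thesis .
qed

text \<open>\<open>nn_integral_mu'_doubled\<close> is used twice, once for the indicator of
  \<open>A \<inter> B\<close> and once, backwards, for its conditional version in \<Lambda>. The two
  inner kernel integrals agree by consistency followed by properness.\<close>

lemma dlr_doubled:
  assumes p: "0 < p" "p < 1" and n: "0 < n" and sub: "\<Lambda> \<subseteq> {-n<..<n}"
    and A: "A \<in> sets (F'_spins (- \<Lambda>))" and B: "B \<in> sets F'" and An: "A \<subseteq> doubled n"
  shows "(\<integral>\<^sup>+\<omega>\<in>A. indicator B \<omega> \<partial>mu' p) = (\<integral>\<^sup>+\<omega>\<in>A. emeasure (gamma' p \<Lambda> \<omega>) B \<partial>mu' p)"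
proof -
  let ?D = "{-n<..<n}"
  have finL: "finite \<Lambda>" using sub finite_subset by blast
  have A': "A \<in> sets F'" using A by (rule sets_F'_spins_subset)
  have AB: "A \<inter> B \<in> sets F'" using A' B by auto
  have g: "(\<lambda>\<omega>. indicator A \<omega> * emeasure (gamma' p \<Lambda> \<omega>) B) \<in> borel_measurable F'"
    using A' measurable_gamma'_F'[OF p finL B] by (intro borel_measurable_times_ennreal) auto
  have "(\<integral>\<^sup>+\<omega>\<in>A. indicator B \<omega> \<partial>mu' p) = (\<integral>\<^sup>+\<omega>. indicator (doubled n) \<omega> * indicator (A \<inter> B) \<omega> \<partial>mu' p)"
    using An by (intro nn_integral_cong) (auto simp: indicator_def)
  also have "\<dots> = (\<integral>\<^sup>+\<omega>. indicator (doubled n) \<omega> * (\<integral>\<^sup>+\<eta>. indicator (A \<inter> B) \<eta> \<partial>gamma' p ?D (thin \<omega>)) \<partial>mu p)"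
    by (rule nn_integral_mu'_doubled[OF p n]) (use AB in simp)
  also have "\<dots> = (\<integral>\<^sup>+\<omega>. indicator (doubled n) \<omega> *
      (\<integral>\<^sup>+\<eta>. indicator A \<eta> * emeasure (gamma' p \<Lambda> \<eta>) B \<partial>gamma' p ?D (thin \<omega>)) \<partial>mu p)"
  proof (rule nn_integral_cong, rule arg_cong2[of _ _ _ _ "(*)"], rule refl)
    fix \<omega>
    let ?G = "gamma' p ?D (thin \<omega>)"
    have s: "sets ?G = sets F'" by (rule sets_gamma'[OF p _ thin_in_Omega']) simp
    have "(\<integral>\<^sup>+\<eta>. indicator (A \<inter> B) \<eta> \<partial>?G) = emeasure ?G (A \<inter> B)"
      using AB s by simp
    also have "\<dots> = (\<integral>\<^sup>+\<eta>. emeasure (gamma' p \<Lambda> \<eta>) (A \<inter> B) \<partial>?G)"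
      by (rule gamma'_consistent[OF p _ sub AB thin_in_Omega', symmetric]) simp
    also have "\<dots> = (\<integral>\<^sup>+\<eta>. indicator A \<eta> * emeasure (gamma' p \<Lambda> \<eta>) B \<partial>?G)"
    proof (rule nn_integral_cong)
      fix \<eta> assume "\<eta> \<in> space ?G"
      then have "\<eta> \<in> Omega'" using sets_eq_imp_space_eq[OF s] by simp
      then show "emeasure (gamma' p \<Lambda> \<eta>) (A \<inter> B) = indicator A \<eta> * emeasure (gamma' p \<Lambda> \<eta>) B"
        by (rule gamma'_proper[OF p finL _ A B])
    qed
    finally show "(\<integral>\<^sup>+\<eta>. indicator (A \<inter> B) \<eta> \<partial>?G) = (\<integral>\<^sup>+\<eta>. indicator A \<eta> * emeasure (gamma' p \<Lambda> \<eta>) B \<partial>?G)" .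
  qed
  also have "\<dots> = (\<integral>\<^sup>+\<omega>. indicator (doubled n) \<omega> * (indicator A \<omega> * emeasure (gamma' p \<Lambda> \<omega>) B) \<partial>mu' p)"
    by (rule nn_integral_mu'_doubled[OF p n g, symmetric])
  also have "\<dots> = (\<integral>\<^sup>+\<omega>\<in>A. emeasure (gamma' p \<Lambda> \<omega>) B \<partial>mu' p)"
    using An by (intro nn_integral_cong) (auto simp: indicator_def)
  finally show ?thesis .
qed

text \<open>Radii spaced by two use disjoint quadruples of sites, so the events are independent,
  each of probability \<open>p ^ 4\<close>. Independence enters by redrawing the outermost
  quadruple.\<close>

lemma emeasure_no_doubled:
  assumes p: "0 < p" "p < 1" and N: "0 < N"
  shows "emeasure (mu p) {\<omega>. \<forall>k<K. \<omega> \<notin> doubled (N + 2 * int k)} = ennreal ((1 - p ^ 4) ^ K)"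
proof (induction K)
  case 0
  interpret M: prob_space "mu p" by (rule prob_space_mu)
  show ?case using M.emeasure_space_1 by (simp add: space_mu)
next
  case (Suc K)
  define E where "E K = {\<omega>. \<forall>k<K. \<omega> \<notin> doubled (N + 2 * int k)}" for K
  have E: "E K \<in> sets OmegaM" for K
  proof -
    have "E K = space OmegaM - (\<Union>k<K. doubled (N + 2 * int k))" by (auto simp: E_def)
    also have "\<dots> \<in> sets OmegaM" using doubled_sets by (intro sets.Diff sets.top sets.finite_UN) auto
    finally show ?thesis .
  qed
  define m where "m = N + 2 * int K"
  define J where "J = {- m - 1, - m, m, m + 1}"
  have mpos: "0 < m" using N by (simp add: m_def)
  \<comment> \<open>Positivity of \<open>m\<close> keeps the left and right pairs apart.\<close>
  have J: "finite J" "card J = 4" using mpos by (auto simp: J_def)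
  have inE: "mrg J X \<omega> \<in> E (Suc K) \<longleftrightarrow> \<omega> \<in> E K \<and> X \<noteq> J" if X: "X \<subseteq> J" for X \<omega>
  proof -
    have "mrg J X \<omega> \<in> doubled (N + 2 * int k) \<longleftrightarrow> \<omega> \<in> doubled (N + 2 * int k)" if k: "k < K" for k
    proof -
      define q where "q = N + 2 * int k"
      have "0 < q" "q + 1 < m" using k N by (auto simp: m_def q_def)
      then have "- q - 1 \<notin> J" "- q \<notin> J" "q \<notin> J" "q + 1 \<notin> J" by (auto simp: J_def)
      then show ?thesis unfolding q_def[symmetric] by (simp add: doubled_def mrg_def)
    qed
    moreover have "mrg J X \<omega> \<in> doubled m \<longleftrightarrow> X = J"
      using X by (auto simp: doubled_def mrg_def J_def)
    ultimately show ?thesis unfolding E_def m_def by (auto simp: less_Suc_eq)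
  qed
  have "emeasure (mu p) (E (Suc K)) = (\<integral>\<^sup>+\<omega>. indicator (E (Suc K)) \<omega> \<partial>mu p)"
    using E by (simp add: sets_mu)
  also have "\<dots> = (\<integral>\<^sup>+\<omega>. (\<Sum>X\<in>Pow J. ennreal (bern_wt p J X) * indicator (E (Suc K)) (mrg J X \<omega>)) \<partial>mu p)"
    by (rule resample[OF p J(1)]) (use E in simp)
  also have "\<dots> = (\<integral>\<^sup>+\<omega>. ennreal (1 - p ^ 4) * indicator (E K) \<omega> \<partial>mu p)"
  proof (rule nn_integral_cong)
    fix \<omega>
    have "(\<Sum>X\<in>Pow J. ennreal (bern_wt p J X) * indicator (E (Suc K)) (mrg J X \<omega>))
      = (\<Sum>X\<in>Pow J - {J}. ennreal (bern_wt p J X) * indicator (E K) \<omega>)"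
      \<comment> \<open>Only the draw filling all of \<open>J\<close> creates the new event; every
        other draw leaves the indicator of the earlier failures.\<close>
      using J(1) by (intro sum.mono_neutral_cong_right) (auto simp: indicator_def inE)
    also have "\<dots> = ennreal (\<Sum>X\<in>Pow J - {J}. bern_wt p J X) * indicator (E K) \<omega>"
      using bern_wt_nonneg[OF p] by (simp add: sum_distrib_right[symmetric] sum_ennreal)
    also have "(\<Sum>X\<in>Pow J - {J}. bern_wt p J X) = 1 - p ^ 4"
      using sum_bern_wt[OF p J(1)] J by (simp add: sum_diff1 bern_wt_def)
    finally show "(\<Sum>X\<in>Pow J. ennreal (bern_wt p J X) * indicator (E (Suc K)) (mrg J X \<omega>))
      = ennreal (1 - p ^ 4) * indicator (E K) \<omega>" .
  qed
  also have "\<dots> = ennreal (1 - p ^ 4) * emeasure (mu p) (E K)"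
    using E by (simp add: sets_mu nn_integral_cmult_indicator)
  also have "\<dots> = ennreal ((1 - p ^ 4) ^ Suc K)"
    using Suc p by (simp add: E_def ennreal_mult power_le_one)
  finally show ?case unfolding E_def .
qed

lemma AE_doubled:
  assumes p: "0 < p" "p < 1" and N: "0 < N"
  shows "AE \<omega> in mu p. \<exists>k. \<omega> \<in> doubled (N + 2 * int k)"
proof -
  let ?E = "{\<omega>. \<forall>k. \<omega> \<notin> doubled (N + 2 * int k)}"
  have E: "?E \<in> sets (mu p)"
  proof -
    have "?E = space OmegaM - (\<Union>k. doubled (N + 2 * int k))" by auto
    also have "\<dots> \<in> sets OmegaM" using doubled_sets by (intro sets.Diff sets.top sets.countable_UN) auto
    finally show ?thesis by (simp add: sets_mu)
  qed
  have le: "emeasure (mu p) ?E \<le> ennreal ((1 - p ^ 4) ^ K)" for K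
  proof -
    have "{\<omega>. \<forall>k<K. \<omega> \<notin> doubled (N + 2 * int k)} \<in> sets (mu p)"
    proof -
      have "{\<omega>. \<forall>k<K. \<omega> \<notin> doubled (N + 2 * int k)} = space OmegaM - (\<Union>k<K. doubled (N + 2 * int k))" by auto
      also have "\<dots> \<in> sets OmegaM" using doubled_sets by (intro sets.Diff sets.top sets.finite_UN) auto
      finally show ?thesis by (simp add: sets_mu)
    qed
    then show ?thesis unfolding emeasure_no_doubled[OF p N, symmetric] by (intro emeasure_mono) auto
  qed
  have "(\<lambda>K. (1 - p ^ 4) ^ K) \<longlonglongrightarrow> 0"
    using p by (intro LIMSEQ_power_zero) (simp add: power_le_one)
  then have "(\<lambda>K. ennreal ((1 - p ^ 4) ^ K)) \<longlonglongrightarrow> ennreal 0" by (rule tendsto_ennrealI)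
  then have "emeasure (mu p) ?E \<le> ennreal 0"
    by (rule LIMSEQ_le_const) (use le in auto)
  then have "?E \<in> null_sets (mu p)" using E by (intro null_setsI) simp_all
  then show ?thesis by (rule AE_I') (auto simp: space_mu)
qed

text \<open>The four sites lie outside \<Lambda>, so restricting to a decoupling event stays within
  the conditioning \<sigma>-algebra.\<close>

lemma doubled_F'_spins:
  assumes "\<Lambda> \<subseteq> {-n<..<n}"
  shows "doubled n \<inter> Omega' \<in> sets (F'_spins (- \<Lambda>))"
proof -
  have s: "(\<lambda>\<omega>. \<omega> i) \<in> measurable (F'_spins (- \<Lambda>)) (count_space UNIV)" if "i \<notin> \<Lambda>" for i
    unfolding F'_spins_def
    by (intro measurable_restrict_space1 measurable_spin_F_spins) (use that in simp)
  have "- n - 1 \<notin> {-n<..<n}" "- n \<notin> {-n<..<n}" "n \<notin> {-n<..<n}" "n + 1 \<notin> {-n<..<n}" by auto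
  then have "- n - 1 \<notin> \<Lambda>" "- n \<notin> \<Lambda>" "n \<notin> \<Lambda>" "n + 1 \<notin> \<Lambda>" using assms by blast+
  note [measurable] = this[THEN s]
  have eq: "doubled n \<inter> Omega' =
      {\<omega> \<in> space (F'_spins (- \<Lambda>)). \<omega> (- n - 1) \<and> \<omega> (- n) \<and> \<omega> n \<and> \<omega> (n + 1)}"
    by (auto simp: doubled_def)
  show ?thesis unfolding eq by measurable
qed

text \<open>Decompose \<open>A\<close> according to the first decoupling event that occurs, apply
  \<open>dlr_doubled\<close> on each piece, and sum. The pieces exhaust \<open>A\<close> up to a
  null set.\<close>

lemma is_gibbs_mu':
  assumes p: "0 < p" "p < 1"
  shows "is_gibbs (gamma' p) (mu' p)"
  unfolding is_gibbs_def
proof (intro conjI allI impI ballI)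
  show "prob_space (mu' p)"
    unfolding mu'_def by (rule prob_space.prob_space_distr[OF prob_space_mu measurable_mu[OF measurable_thin]])
  show "sets (mu' p) = sets F'" by simp
  fix \<Lambda> :: "int set" and B A
  assume fin: "finite \<Lambda>" and B: "B \<in> sets F'" and A: "A \<in> sets (F'_spins (- \<Lambda>))"
  have A': "A \<in> sets F'" using A by (rule sets_F'_spins_subset)
  obtain N where N: "0 < N" "\<Lambda> \<subseteq> {-N<..<N}"
  proof -
    have "\<bar>i\<bar> \<le> Max (insert 0 (abs ` \<Lambda>))" if "i \<in> \<Lambda>" for i using fin that by simp
    moreover have "0 \<le> Max (insert 0 (abs ` \<Lambda>))" using fin by simp
    ultimately show ?thesis
      by (intro that[of "Max (insert 0 (abs ` \<Lambda>)) + 1"]) force+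
  qed
  define G where "G k = doubled (N + 2 * int k) \<inter> Omega'" for k
  \<comment> \<open>\<open>D k\<close> says that \<open>k\<close> is the first index for which the
    event occurs. It involves only sites outside \<Lambda>, so intersecting \<open>A\<close> with it
    gives another admissible event.\<close>
  define D where "D = disjointed G"
  have Lk: "\<Lambda> \<subseteq> {-(N + 2 * int k)<..<N + 2 * int k}" for k
    by (rule order_trans[OF N(2)]) auto
  have Gs: "range G \<subseteq> sets (F'_spins (- \<Lambda>))"
    using doubled_F'_spins[OF Lk] by (auto simp: G_def)
  have Ds: "D k \<in> sets (F'_spins (- \<Lambda>))" for k
    using sets.range_disjointed_sets[OF Gs] by (auto simp: D_def)
  have AD: "A \<inter> D k \<in> sets (F'_spins (- \<Lambda>))" for k using A Ds by auto
  have dis: "disjoint_family (\<lambda>k. A \<inter> D k)"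
    using disjoint_family_disjointed[of G] by (auto simp: disjoint_family_on_def D_def)
  have step: "(\<integral>\<^sup>+\<omega>\<in>A \<inter> D k. indicator B \<omega> \<partial>mu' p) = (\<integral>\<^sup>+\<omega>\<in>A \<inter> D k. emeasure (gamma' p \<Lambda> \<omega>) B \<partial>mu' p)" for k
  proof (rule dlr_doubled[OF p _ Lk AD B])
    show "0 < N + 2 * int k" using N by simp
    show "A \<inter> D k \<subseteq> doubled (N + 2 * int k)"
      using disjointed_subset[of G k] by (auto simp: D_def G_def)
  qed
  have AE: "AE \<omega> in mu' p. \<omega> \<in> (\<Union>k. G k)"
  proof -
    have U: "{\<omega> \<in> space F'. \<omega> \<in> (\<Union>k. G k)} \<in> sets F'"
    proof -
      have "(\<Union>k. G k) \<in> sets F'"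
        using Gs sets_F'_spins_subset by (intro sets.countable_UN) blast
      moreover have "{\<omega> \<in> space F'. \<omega> \<in> (\<Union>k. G k)} = (\<Union>k. G k)" by (auto simp: G_def)
      ultimately show ?thesis by (simp only:)
    qed
    \<comment> \<open>Pulled back along \<open>thin\<close>, the claim concerns the Bernoulli field,
      where \<open>AE_doubled\<close> applies because thinning preserves each decoupling
      event.\<close>
    show ?thesis unfolding mu'_def AE_distr_iff[OF measurable_mu[OF measurable_thin] U]
      using AE_doubled[OF p N(1)]
      by (rule AE_mp) (auto simp: G_def thin_doubled thin_in_Omega')
  qed
  have split: "(\<integral>\<^sup>+\<omega>\<in>A. f \<omega> \<partial>mu' p) = (\<Sum>k. \<integral>\<^sup>+\<omega>\<in>A \<inter> D k. f \<omega> \<partial>mu' p)"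
    if f: "f \<in> borel_measurable F'" for f :: "cfg \<Rightarrow> ennreal"
  proof -
    have "(\<integral>\<^sup>+\<omega>\<in>A. f \<omega> \<partial>mu' p) = (\<integral>\<^sup>+\<omega>\<in>(\<Union>k. A \<inter> D k). f \<omega> \<partial>mu' p)"
    proof (rule nn_integral_cong_AE, use AE in eventually_elim)
      fix \<omega> assume "\<omega> \<in> (\<Union>k. G k)"
      then have "\<omega> \<in> (\<Union>k. D k)" unfolding D_def UN_disjointed_eq .
      then show "f \<omega> * indicator A \<omega> = f \<omega> * indicator (\<Union>k. A \<inter> D k) \<omega>"
        by (auto simp: indicator_def)
    qed
    also have "\<dots> = (\<Sum>k. \<integral>\<^sup>+\<omega>\<in>A \<inter> D k. f \<omega> \<partial>mu' p)"
      by (rule nn_integral_disjoint_family[OF _ _ dis])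
        (use f AD sets_F'_spins_subset in \<open>auto cong: measurable_cong_sets\<close>)
    finally show ?thesis .
  qed
  have "emeasure (mu' p) (A \<inter> B) = (\<integral>\<^sup>+\<omega>. indicator (A \<inter> B) \<omega> \<partial>mu' p)"
    using A' B by (intro nn_integral_indicator[symmetric]) auto
  also have "\<dots> = (\<integral>\<^sup>+\<omega>\<in>A. indicator B \<omega> \<partial>mu' p)"
    by (intro nn_integral_cong) (auto simp: indicator_def)
  also have "\<dots> = (\<Sum>k. \<integral>\<^sup>+\<omega>\<in>A \<inter> D k. indicator B \<omega> \<partial>mu' p)" by (rule split) (use B in simp)
  also have "\<dots> = (\<Sum>k. \<integral>\<^sup>+\<omega>\<in>A \<inter> D k. emeasure (gamma' p \<Lambda> \<omega>) B \<partial>mu' p)"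
    by (simp only: step)
  also have "\<dots> = (\<integral>\<^sup>+\<omega>\<in>A. emeasure (gamma' p \<Lambda> \<omega>) B \<partial>mu' p)"
    by (rule split[OF measurable_gamma'_F'[OF p fin B], symmetric])
  finally show "emeasure (mu' p) (A \<inter> B) = (\<integral>\<^sup>+\<omega>\<in>A. emeasure (gamma' p \<Lambda> \<omega>) B \<partial>mu' p)" .
qed

theorem theorem3p1:
  fixes p :: real
  assumes "0 < p" and "p < 1"
  shows "is_specification (gamma' p) \<and> is_gibbs (gamma' p) (mu' p)"
  using is_specification_gamma'[OF assms] is_gibbs_mu'[OF assms] by blast

end
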